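(* Let $\Gamma_+=\{(x_1,x_2)\in\mathbb{R}^2: x_1x_2=1,\ x_1>0\}$ and let $\alpha,\beta>0$ be real numbers with $\alpha\beta>4$. Then the complex vector space $\mathrm{AC}(\Gamma_+;\Lambda_{\alpha,\beta})$ is infinite-dimensional.
   Context: For $\alpha,\beta>0$ the lattice-cross is $\Lambda_{\alpha,\beta}=(\alpha\mathbb{Z}\times\{0\})\cup(\{0\}\times\beta\mathbb{Z})\subset\mathbb{R}^2$. For a finite disjoint union $\Gamma$ of smooth curves in the plane and a set $\Lambda\subset\mathbb{R}^2$, $\mathrm{AC}(\Gamma;\Lambda)$ denotes the space of finite complex Borel measures $\mu$ on $\mathbb{R}^2$ that are supported on $\Gamma$, absolutely continuous with respect to arc length on $\Gamma$, and whose Fourier transform $$\widehat{\mu}(x_1,x_2)=\int_{\Gamma} e^{i\pi(x_1y_1+x_2y_2)}\,d\mu(y_1,y_2),\qquad (x_1,x_2)\in\mathbb{R}^2,$$ vanishes at every point of $\Lambda$. *)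

theory Defs
  imports "HOL-Analysis.Analysis" "HOL-Library.Function_Algebras"
begin

section \<open>Complex Borel measures\<close>

text \<open>
  A finite complex Borel measure is a countably additive complex-valued set function on the Borel
  sets. It is normalised to vanish off the Borel sets, so that equality of functions is equality of
  measures. Countable additivity already forces the value 0 on the empty set.
\<close>

definition complex_borel_measure :: "('a::topological_space set \<Rightarrow> complex) \<Rightarrow> bool" where
  "complex_borel_measure \<mu> \<longleftrightarrow>
     (\<forall>A. A \<notin> sets borel \<longrightarrow> \<mu> A = 0) \<and>
     (\<forall>A :: nat \<Rightarrow> 'a set. range A \<subseteq> sets borel \<longrightarrow> disjoint_family A \<longrightarrow>
        (\<lambda>n. \<mu> (A n)) sums \<mu> (\<Union>n. A n))"

text \<open>
  The positive part of the Jordan decomposition of a finite signed Borel measure; the negative part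
  is the positive part of the negated measure. Negative values are truncated to 0 by
  \<^const>\<open>ennreal\<close>, which is harmless because the empty set is among the competitors.
\<close>

definition positive_part :: "('a::topological_space set \<Rightarrow> real) \<Rightarrow> 'a measure" where
  "positive_part \<nu> =
     measure_of UNIV (sets borel) (\<lambda>A. SUP B\<in>{B \<in> sets borel. B \<subseteq> A}. ennreal (\<nu> B))"

definition complex_measure_integral ::
    "('a::topological_space set \<Rightarrow> complex) \<Rightarrow> ('a \<Rightarrow> complex) \<Rightarrow> complex" where
  "complex_measure_integral \<mu> f =
     (integral\<^sup>L (positive_part (\<lambda>A. Re (\<mu> A))) f - integral\<^sup>L (positive_part (\<lambda>A. - Re (\<mu> A))) f) +
     \<i> * (integral\<^sup>L (positive_part (\<lambda>A. Im (\<mu> A))) f - integral\<^sup>L (positive_part (\<lambda>A. - Im (\<mu> A))) f)"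

definition fourier_transform :: "((real \<times> real) set \<Rightarrow> complex) \<Rightarrow> real \<times> real \<Rightarrow> complex" where
  "fourier_transform \<mu> x = complex_measure_integral \<mu>
     (\<lambda>y. exp (\<i> * complex_of_real (pi * (fst x * fst y + snd x * snd y))))"


section \<open>Arc length\<close>

definition regular_arcs :: "(real \<times> real) set \<Rightarrow> (real set \<times> (real \<Rightarrow> real \<times> real)) set" where
  "regular_arcs \<Gamma> = {(I, \<gamma>). open I \<and> is_interval I \<and> \<gamma> ` I \<subseteq> \<Gamma> \<and> inj_on \<gamma> I \<and>
     \<gamma> C1_differentiable_on I \<and> (\<forall>t\<in>I. vector_derivative \<gamma> (at t) \<noteq> 0)}"

text \<open>The arc length measure of a single parametrised arc: the image under \<open>\<gamma>\<close> of the speed times Lebesgue measure.\<close>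

definition arc_length_param :: "real set \<Rightarrow> (real \<Rightarrow> real \<times> real) \<Rightarrow> (real \<times> real) measure" where
  "arc_length_param I \<gamma> =
     distr (density (restrict_space lborel I) (\<lambda>t. ennreal (norm (vector_derivative \<gamma> (at t)))))
       borel \<gamma>"

text \<open>
  Arc length on a union of smooth curves does not depend on the parametrisations: by injectivity,
  the arc length measure of a regular arc in \<open>\<Gamma>\<close> is the restriction of arc length to that arc, so
  arc length on \<open>\<Gamma>\<close> is the supremum of these measures in the lattice of measures. All of them are
  measures on the Borel sets, and the family is nonempty since the empty interval is allowed.
\<close>

definition arc_length :: "(real \<times> real) set \<Rightarrow> (real \<times> real) measure" where
  "arc_length \<Gamma> = (SUP (I, \<gamma>)\<in>regular_arcs \<Gamma>. arc_length_param I \<gamma>)"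


section \<open>The space of measures and its dimension\<close>

definition AC :: "(real \<times> real) set \<Rightarrow> (real \<times> real) set \<Rightarrow> ((real \<times> real) set \<Rightarrow> complex) set" where
  "AC \<Gamma> \<Lambda> = {\<mu>. complex_borel_measure \<mu> \<and>
     (\<forall>A \<in> sets borel. A \<inter> \<Gamma> = {} \<longrightarrow> \<mu> A = 0) \<and>
     (\<forall>A \<in> null_sets (arc_length \<Gamma>). \<mu> A = 0) \<and>
     (\<forall>x \<in> \<Lambda>. fourier_transform \<mu> x = 0)}"

definition lattice_cross :: "real \<Rightarrow> real \<Rightarrow> (real \<times> real) set" where
  "lattice_cross \<alpha> \<beta> = range (\<lambda>m::int. (\<alpha> * of_int m, 0)) \<union> range (\<lambda>n::int. (0, \<beta> * of_int n))"

definition hyperbola_plus :: "(real \<times> real) set" where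
  "hyperbola_plus = {(x1, x2). x1 * x2 = 1 \<and> x1 > 0}"

interpretation complex_fun: vector_space "\<lambda>(c::complex) (f::'a \<Rightarrow> complex) x. c * f x"
  by unfold_locales (auto simp: fun_eq_iff algebra_simps)

text \<open>For a linear subspace \<open>V\<close>, as here, this says that \<open>V\<close> has no finite spanning set.\<close>

definition infinite_dimensional :: "('a \<Rightarrow> complex) set \<Rightarrow> bool" where
  "infinite_dimensional V \<longleftrightarrow> \<not> (\<exists>B. finite B \<and> V \<subseteq> complex_fun.span B)"

end

theory Submission
  imports Defs "HOL-Complex_Analysis.Great_Picard"
begin

text \<open>
  Dividing \<open>\<alpha>\<close> by an integer, which enlarges the lattice-cross, we may assume \<open>4 < \<alpha>\<beta> \<le> 8\<close>. After the
  scaling \<open>x\<^sub>1 = c t\<close>, \<open>c = \<surd>(\<beta>/\<alpha>)\<close>, the conditions on a measure on \<open>\<Gamma>\<^sub>+\<close> say that its images under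
  \<open>t\<close> and \<open>1/t\<close> vanish modulo the period \<open>p = 2/\<surd>(\<alpha>\<beta>) < 1\<close>. It suffices to find a positive density \<open>a\<close> on
  \<open>(0,1)\<close> whose images under \<open>t\<close> and \<open>1/t\<close> agree modulo \<open>p\<close>: then \<open>a\<close> minus its image under inversion
  works, and the two parts are mutually singular, so this is a Jordan decomposition. Because \<open>p < 1\<close>,
  points of \<open>(0,1)\<close> overlap modulo \<open>p\<close>, and we may prescribe the proportion \<open>chi\<close> in which the mass is
  split between \<open>t\<close> and \<open>t + p\<close>. Then \<open>a\<close> corresponds to a density on \<open>\<real>/p\<int>\<close> invariant under a random
  continued fraction map. Its transfer operator satisfies a Lasota-Yorke inequality for Lipschitz
  densities, so the Arzela-Ascoli theorem applied to Cesaro means yields a continuous invariant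
  density, which is positive because the map is expanding. Choosing \<open>chi\<close> with support exactly
  \<open>[0, p + r]\<close> for a sequence of values \<open>r\<close> decreasing to 0 gives linearly independent solutions.
\<close>

subsection \<open>Preliminaries\<close>

text \<open>The right-hand side is the integral of x^(-4) over the unit interval centred at
  \<open>z\<close>, and convexity puts the midpoint value below it. With q = z^2 - 1/4 this reduces
  to q^3 \<le> z^6.\<close>

lemma inverse_fourth_le_telescope:
  fixes z :: real
  assumes "z > 1/2"
  shows "1 / z^4 \<le> (1 / (z - 1/2)^3 - 1 / (z + 1/2)^3) / 3"
proof -
  define q where "q = z\<^sup>2 - 1/4"
  have q: "q = (z - 1/2) * (z + 1/2)"
    by (simp add: q_def power2_eq_square algebra_simps)
  have q0: "q > 0" using assms by (simp add: q)
  have "q ^ 3 \<le> (z\<^sup>2) ^ 3"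
    by (rule power_mono) (use q0 in \<open>auto simp: q_def\<close>)
  then have "3 * q^3 \<le> z^4 * (3 * z\<^sup>2 + 1/4)"
    by (simp add: algebra_simps flip: power_mult power_add) (auto intro: add_increasing2)
  then have "3 / z^4 \<le> (3 * z\<^sup>2 + 1/4) / q^3"
    using assms q0 by (simp add: divide_simps mult.commute)
  moreover have "1 / (z - 1/2)^3 - 1 / (z + 1/2)^3 = (3 * z\<^sup>2 + 1/4) / q^3"
    using assms by (simp add: q power_mult_distrib divide_simps) (simp add: power2_eq_square power3_eq_cube algebra_simps)
  ultimately have "3 / z^4 \<le> 1 / (z - 1/2)^3 - 1 / (z + 1/2)^3"
    by simp
  then show ?thesis by simp
qed

text \<open>Centring the telescoping cells at the points z + j keeps the constant small enough for
  \<open>lip_transfer\<close>, where 1 + 64/81 must stay below 9/5.\<close>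

lemma sums_inverse_fourth_le:
  fixes z :: real
  assumes "z > 1/2"
  shows "summable (\<lambda>j. 1 / (z + real j)^4)"
    and "(\<Sum>j. 1 / (z + real j)^4) \<le> 1 / (3 * (z - 1/2)^3)"
proof -
  define g where "g = (\<lambda>j. 1 / (3 * (z - 1/2 + real j)^3))"
  have "g \<longlonglongrightarrow> 0" unfolding g_def by real_asymp
  then have *: "(\<lambda>j. g j - g (Suc j)) sums (g 0 - 0)" by (rule telescope_sums')
  have le: "1 / (z + real j)^4 \<le> g j - g (Suc j)" for j
    using inverse_fourth_le_telescope[of "z + real j"] assms
    by (simp add: g_def algebra_simps diff_divide_distrib)
  show sm: "summable (\<lambda>j. 1 / (z + real j)^4)"
    by (rule summable_comparison_test'[OF sums_summable[OF *], of 0]) (use le assms in auto)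
  show "(\<Sum>j. 1 / (z + real j)^4) \<le> 1 / (3 * (z - 1/2)^3)"
    using suminf_le[OF le sm sums_summable[OF *]] sums_unique[OF *] by (simp add: g_def)
qed

section \<open>Substitutions for nonnegative integrals\<close>

lemma nn_integral_inversion:
  fixes f :: "real \<Rightarrow> ennreal"
  assumes [measurable]: "f \<in> borel_measurable borel"
  shows "(\<integral>\<^sup>+s. f (1/s) * ennreal (1/s\<^sup>2) * indicator {1<..} s \<partial>lborel) = (\<integral>\<^sup>+t. f t * indicator {0<..<1} t \<partial>lborel)"
proof -
  define g where "g n = (\<lambda>s. f (1/s) * ennreal (1/s\<^sup>2) * indicator {1..real (n + 2)} s)" for n :: nat
  define h where "h n = (\<lambda>t. f t * indicator {1 / real (n + 2)..1} t)" for n :: nat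
  have eq: "integral\<^sup>N lborel (g n) = integral\<^sup>N lborel (h n)" for n
  proof -
    \<comment> \<open>The substitution rule wants an increasing map on a compact interval, so
      \<open>-(1/x)\<close> replaces \<open>1/x\<close> and a reflection undoes the sign.\<close>
    have "(\<integral>\<^sup>+x. f (-x) * indicator {- (1/1)..- (1 / real (n+2))} x \<partial>lborel) =
        (\<integral>\<^sup>+x. f (- (- (1/x))) * ennreal (1/x\<^sup>2) * indicator {1..real (n+2)} x \<partial>lborel)"
    proof (rule nn_integral_substitution_aux[where g = "\<lambda>x. - (1/x)"])
      show "((\<lambda>x. - (1/x)) has_real_derivative 1/x\<^sup>2) (at x)" if "x \<in> {1..real (n+2)}" for x
        using that by (auto intro!: derivative_eq_intros simp: power2_eq_square)
    qed (auto intro!: continuous_intros)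
    also have "(\<integral>\<^sup>+x. f (-x) * indicator {- (1/1)..- (1 / real (n+2))} x \<partial>lborel) = (\<integral>\<^sup>+x. h n (0 + (-1) * x) \<partial>lborel)"
      by (intro nn_integral_cong) (auto simp: h_def indicator_def)
    also have "\<dots> = integral\<^sup>N lborel (h n)"
      by (subst nn_integral_real_affine[of "h n" "-1" 0]) (auto simp: h_def)
    finally show ?thesis by (simp add: g_def)
  qed
  have inc: "incseq g" "incseq h"
  proof -
    have "{1..real (m + 2)} \<subseteq> {1..real (n + 2)}" "{1 / real (m + 2)..1} \<subseteq> {1 / real (n + 2)..1}" if "m \<le> n" for m n
      using that by (auto simp: frac_le elim!: order_trans[rotated])
    then show "incseq g" "incseq h"
      unfolding g_def h_def incseq_def le_fun_def by (auto intro!: mult_left_mono simp: indicator_leI subset_eq)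
  qed
  have meas: "g n \<in> borel_measurable lborel" "h n \<in> borel_measurable lborel" for n
    unfolding g_def h_def by measurable
  \<comment> \<open>Monotone convergence along compact intervals; they differ from the open ranges
    only by the null set {1}.\<close>
  have "(\<integral>\<^sup>+s. f (1/s) * ennreal (1/s\<^sup>2) * indicator {1<..} s \<partial>lborel) = (\<integral>\<^sup>+s. (SUP n. g n s) \<partial>lborel)"
  proof (rule nn_integral_cong_AE)
    have *: "(SUP n. g n s) = f (1/s) * ennreal (1/s\<^sup>2) * indicator {1<..} s" if "s \<noteq> 1" for s
    proof (rule antisym)
      show "(SUP n. g n s) \<le> f (1/s) * ennreal (1/s\<^sup>2) * indicator {1<..} s"
        using that by (intro SUP_least) (auto simp: g_def indicator_def)
      obtain n :: nat where "s \<le> real n" using real_arch_simple by blast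
      then have "f (1/s) * ennreal (1/s\<^sup>2) * indicator {1<..} s \<le> g n s"
        by (auto simp: g_def indicator_def)
      then show "f (1/s) * ennreal (1/s\<^sup>2) * indicator {1<..} s \<le> (SUP n. g n s)"
        by (rule order_trans) (rule SUP_upper, simp)
    qed
    show "AE s in lborel. f (1/s) * ennreal (1/s\<^sup>2) * indicator {1<..} s = (SUP n. g n s)"
      using AE_lborel_singleton[of 1] by eventually_elim (rule *[symmetric])
  qed
  also have "\<dots> = (SUP n. integral\<^sup>N lborel (g n))"
    by (rule nn_integral_monotone_convergence_SUP[OF inc(1) meas(1)])
  also have "\<dots> = (SUP n. integral\<^sup>N lborel (h n))" by (simp add: eq)
  also have "\<dots> = (\<integral>\<^sup>+s. (SUP n. h n s) \<partial>lborel)"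
    by (rule nn_integral_monotone_convergence_SUP[OF inc(2) meas(2), symmetric])
  also have "\<dots> = (\<integral>\<^sup>+t. f t * indicator {0<..<1} t \<partial>lborel)"
  proof (rule nn_integral_cong_AE)
    have *: "(SUP n. h n t) = f t * indicator {0<..<1} t" if "t \<noteq> 1" for t
    proof (rule antisym)
      show "(SUP n. h n t) \<le> f t * indicator {0<..<1} t"
        using that by (intro SUP_least) (auto simp: h_def indicator_def intro: less_le_trans[of 0 "1 / (2 + real _)"])
      obtain n :: nat where "1/t \<le> real n" using real_arch_simple by blast
      then have "f t * indicator {0<..<1} t \<le> h n t"
        by (auto simp: h_def indicator_def field_simps)
      then show "f t * indicator {0<..<1} t \<le> (SUP n. h n t)"
        by (rule order_trans) (rule SUP_upper, simp)
    qed
    show "AE t in lborel. (SUP n. h n t) = f t * indicator {0<..<1} t"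
      using AE_lborel_singleton[of 1] by eventually_elim (rule *)
  qed
  finally show ?thesis .
qed

text \<open>The half line is cut into cells of length \<open>p\<close>, each translated back to
  [0,p). Starting at \<open>p\<close> suits functions such as \<open>branch H\<close>, which vanish
  up to 1 > p.\<close>

lemma nn_integral_periodize:
  fixes f :: "real \<Rightarrow> ennreal"
  assumes [measurable]: "f \<in> borel_measurable borel" and p: "0 < p"
  shows "(\<integral>\<^sup>+s. f s * indicator {p..} s \<partial>lborel) = (\<integral>\<^sup>+t. (\<Sum>j. f (t + real (Suc j) * p)) * indicator {0..<p} t \<partial>lborel)"
proof -
  define I where "I j = {real (Suc j) * p ..< real (Suc (Suc j)) * p}" for j
  have disj: "disjoint_family I"
    unfolding disjoint_family_on_def
  proof (intro ballI impI)
    have "I i \<inter> I j = {}" if "i < j" for i j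
    proof -
      have "real (Suc (Suc i)) * p \<le> real (Suc j) * p" using that p by (intro mult_right_mono) auto
      then show ?thesis by (auto simp: I_def)
    qed
    then show "I i \<inter> I j = {}" if "i \<noteq> j" for i j using that by (metis Int_commute linorder_neqE_nat)
  qed
  have un: "{p..} = (\<Union>j. I j)"
  proof (intro equalityI subsetI)
    fix s assume s: "s \<in> {p..}"
    define n where "n = nat \<lfloor>s / p\<rfloor>"
    have "1 \<le> s / p" using s p by simp
    then have n1: "1 \<le> n" and n: "real n \<le> s / p" "s / p < real n + 1" by (auto simp: n_def nat_le_iff le_nat_iff le_floor_iff) 
    then have "s \<in> I (n - 1)" using p by (auto simp: I_def field_simps of_nat_diff)
    then show "s \<in> (\<Union>j. I j)" by blast
  next
    fix s assume "s \<in> (\<Union>j. I j)"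
    then obtain j where "real (Suc j) * p \<le> s" by (auto simp: I_def)
    moreover have "1 * p \<le> real (Suc j) * p" using p by (intro mult_right_mono) auto
    ultimately show "s \<in> {p..}" by simp
  qed
  have I[measurable]: "I j \<in> sets borel" for j by (simp add: I_def)
  have "(\<integral>\<^sup>+s. f s * indicator {p..} s \<partial>lborel) = (\<integral>\<^sup>+s. f s * indicator (\<Union>j. I j) s \<partial>lborel)" by (simp add: un)
  also have "\<dots> = (\<integral>\<^sup>+s. (\<Sum>j. f s * indicator (I j) s) \<partial>lborel)"
    by (simp add: ennreal_suminf_cmult suminf_indicator[OF disj])
  also have "\<dots> = (\<Sum>j. \<integral>\<^sup>+s. f s * indicator (I j) s \<partial>lborel)"
    by (rule nn_integral_suminf) measurable
  also have "\<dots> = (\<Sum>j. \<integral>\<^sup>+t. f (t + real (Suc j) * p) * indicator {0..<p} t \<partial>lborel)"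
  proof (rule suminf_cong)
    fix j
    have "(\<integral>\<^sup>+s. f s * indicator (I j) s \<partial>lborel) = (\<integral>\<^sup>+t. f (real (Suc j) * p + 1 * t) * indicator (I j) (real (Suc j) * p + 1 * t) \<partial>lborel)"
      by (subst nn_integral_real_affine[where c = 1 and t = "real (Suc j) * p"]) auto
    also have "\<dots> = (\<integral>\<^sup>+t. f (t + real (Suc j) * p) * indicator {0..<p} t \<partial>lborel)"
      by (intro nn_integral_cong) (auto simp: I_def indicator_def algebra_simps)
    finally show "(\<integral>\<^sup>+s. f s * indicator (I j) s \<partial>lborel) = (\<integral>\<^sup>+t. f (t + real (Suc j) * p) * indicator {0..<p} t \<partial>lborel)" .
  qed
  also have "\<dots> = (\<integral>\<^sup>+t. (\<Sum>j. f (t + real (Suc j) * p) * indicator {0..<p} t) \<partial>lborel)"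
    by (rule nn_integral_suminf[symmetric]) measurable
  also have "\<dots> = (\<integral>\<^sup>+t. (\<Sum>j. f (t + real (Suc j) * p)) * indicator {0..<p} t \<partial>lborel)"
    by (simp add: ennreal_suminf_multc)
  finally show ?thesis .
qed

subsection \<open>The random continued fraction map and its transfer operator\<close>

text \<open>Here \<open>p\<close> is the period, and p^2 \<ge> 1/2 corresponds to \<alpha>\<beta>
  \<le> 8. The graph of \<open>chi\<close> below is a trapezoid over [0, p + r] with ramps of length
  \<open>r\<close>; \<open>r_le\<close> keeps its base inside [0,1].\<close>

locale trapezoid =
  fixes p r :: real
  assumes p_sq: "1/2 \<le> p * p" and p_pos: "0 < p" and p_less_1: "p < 1"
    and r_pos: "0 < r" and r_le: "r \<le> 1 - p"
begin

lemma p_gt: "7/10 < p"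
proof (rule ccontr)
  assume "\<not> 7/10 < p"
  then have "p * p \<le> 7/10 * (7/10)" using p_pos by (intro mult_mono) auto
  then show False using p_sq by simp
qed

text \<open>A point \<open>t\<close> of the circle \<open>\<real>/p\<int>\<close> is lifted to \<open>t\<close> with probability \<open>chi t\<close> and to \<open>t + p\<close>
  with probability \<open>chi (t + p)\<close>, and the lift is then inverted. Since \<open>chi\<close> is Lipschitz and vanishes
  at the end points of \<open>[0,1]\<close>, the transfer operator of this random map creates no discontinuities.\<close>

definition chi :: "real \<Rightarrow> real" where
  "chi t = max 0 (min 1 (min (t / r) ((p + r - t) / r)))"

lemma chi_nonneg: "0 \<le> chi t" and chi_le_1: "chi t \<le> 1"
  by (auto simp: chi_def)

lemma chi_eq_0: "p + r \<le> t \<Longrightarrow> chi t = 0"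
  using r_pos by (auto simp: chi_def max_def min_def divide_simps)

lemma chi_pos: "0 < t \<Longrightarrow> t < p + r \<Longrightarrow> 0 < chi t"
  using r_pos by (auto simp: chi_def)

text \<open>The falling ramp on [p, p + r] is one minus the rising ramp on [0,r], shifted by
  \<open>p\<close>.\<close>

lemma chi_partition:
  assumes "0 \<le> t" "t \<le> p"
  shows "chi t + chi (t + p) = 1"
proof -
  have "(p + r - t) / r \<ge> 1" "(t + p) / r \<ge> 1"
    using assms r_pos r_le p_gt by (auto simp: le_divide_eq)
  then have *: "chi t = max 0 (min 1 (t / r))" "chi (t + p) = max 0 (min 1 (1 - t / r))"
    using r_pos by (auto simp: chi_def diff_divide_distrib add_divide_distrib)
  show ?thesis
    using assms r_pos by (cases "t \<le> r") (auto simp: *)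
qed

lemma chi_lipschitz: "\<bar>chi x - chi y\<bar> \<le> \<bar>x - y\<bar> / r"
proof -
  have "\<bar>x / r - y / r\<bar> = \<bar>x - y\<bar> / r" "\<bar>(p + r - x) / r - (p + r - y) / r\<bar> = \<bar>x - y\<bar> / r"
    using r_pos by (auto simp: abs_if divide_simps)
  then show ?thesis unfolding chi_def by linarith
qed

lemma continuous_on_chi: "continuous_on S chi"
  unfolding chi_def using r_pos by (intro continuous_intros) auto

lemma chi_measurable [measurable]: "chi \<in> borel_measurable borel"
  by (rule borel_measurable_continuous_onI) (rule continuous_on_chi)

section \<open>The transfer operator and its bounds in the supremum norm\<close>

text \<open>The point \<open>p\<close> is not moved to 0; for densities with
  \<open>H 0 = H p\<close> the two represent the same point of the circle.\<close>

definition wrap :: "real \<Rightarrow> real" where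
  "wrap t = (if t \<le> p then t else t - p)"

lemma wrap_in: "0 \<le> t \<Longrightarrow> t \<le> 1 \<Longrightarrow> wrap t \<in> {0..p}"
  using p_gt by (auto simp: wrap_def)

lemma wrap_measurable [measurable]: "wrap \<in> borel_measurable borel"
  unfolding wrap_def by measurable

text \<open>Density of the inverted lift, with Jacobian 1/s^2. It is 0 for s \<le> 1 because lifts
  lie in (0,1), and since \<open>chi 1 = 0\<close> there is no jump at 1 for bounded
  \<open>H\<close>.\<close>

definition branch :: "(real \<Rightarrow> real) \<Rightarrow> real \<Rightarrow> real" where
  "branch H s = (if s \<le> 1 then 0 else chi (1/s) * H (wrap (1/s)) / s\<^sup>2)"

text \<open>The sum folds the inverted density modulo \<open>p\<close>. It starts at t + p because
  \<open>branch\<close> vanishes on [0,p].\<close>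

definition transfer :: "(real \<Rightarrow> real) \<Rightarrow> real \<Rightarrow> real" where
  "transfer H t = (\<Sum>j. branch H (t + real (Suc j) * p))"

definition tail_const :: real where
  "tail_const = (\<Sum>j. 1 / (real (Suc j) * p)\<^sup>2)"

lemma summable_tail: "summable (\<lambda>j. 1 / (real (Suc j) * p)\<^sup>2)"
proof -
  have "summable (\<lambda>j. 1 / real (Suc j)^2 * (1 / p\<^sup>2))"
    using inverse_squares_sums by (intro summable_mult2) (auto simp: sums_iff add.commute)
  then show ?thesis by (simp add: power_mult_distrib)
qed

lemma tail_const_nonneg: "0 \<le> tail_const"
  unfolding tail_const_def by (intro suminf_nonneg summable_tail) auto

lemma branch_bound:
  assumes "\<And>t. t \<in> {0..p} \<Longrightarrow> \<bar>H t\<bar> \<le> K" "0 < s"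
  shows "\<bar>branch H s\<bar> \<le> K / s\<^sup>2"
proof -
  have K: "0 \<le> K" using assms(1)[of 0] p_pos by force
  show ?thesis
  proof (cases "s \<le> 1")
    case False
    have "\<bar>chi (1/s) * H (wrap (1/s))\<bar> \<le> 1 * K"
      unfolding abs_mult using False
      by (intro mult_mono assms wrap_in) (auto simp: chi_nonneg chi_le_1)
    then show ?thesis using False by (simp add: branch_def abs_mult divide_right_mono)
  qed (use K in \<open>auto simp: branch_def\<close>)
qed

lemma branch_term_bound:
  assumes "\<And>t. t \<in> {0..p} \<Longrightarrow> \<bar>H t\<bar> \<le> K" "0 \<le> t"
  shows "\<bar>branch H (t + real (Suc j) * p)\<bar> \<le> K * (1 / (real (Suc j) * p)\<^sup>2)"
proof -
  have K: "0 \<le> K" using assms(1)[of 0] p_pos by force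
  have pos: "0 < real (Suc j) * p" using p_pos by simp
  have "\<bar>branch H (t + real (Suc j) * p)\<bar> \<le> K / (t + real (Suc j) * p)\<^sup>2"
    by (rule branch_bound) (use assms pos in auto)
  also have "\<dots> \<le> K / (real (Suc j) * p)\<^sup>2"
    using pos assms K by (intro divide_left_mono power_mono mult_pos_pos zero_less_power p_pos) linarith+
  finally show ?thesis by simp
qed

lemma summable_branch:
  assumes "\<And>t. t \<in> {0..p} \<Longrightarrow> \<bar>H t\<bar> \<le> K" "0 \<le> t"
  shows "summable (\<lambda>j. branch H (t + real (Suc j) * p))"
  by (rule summable_comparison_test'[OF summable_mult[OF summable_tail, of K], of 0])
     (use branch_term_bound[OF assms] in auto)

lemma transfer_bound:
  assumes "\<And>t. t \<in> {0..p} \<Longrightarrow> \<bar>H t\<bar> \<le> K" "0 \<le> t"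
  shows "\<bar>transfer H t\<bar> \<le> K * tail_const"
proof -
  have s: "summable (\<lambda>j. \<bar>branch H (t + real (Suc j) * p)\<bar>)"
    by (rule summable_comparison_test'[OF summable_mult[OF summable_tail, of K], of 0])
       (use branch_term_bound[OF assms] in auto)
  have "\<bar>transfer H t\<bar> \<le> (\<Sum>j. \<bar>branch H (t + real (Suc j) * p)\<bar>)"
    unfolding transfer_def by (rule summable_rabs[OF s])
  also have "\<dots> \<le> (\<Sum>j. K * (1 / (real (Suc j) * p)\<^sup>2))"
    by (rule suminf_le[OF _ s summable_mult[OF summable_tail]]) (rule branch_term_bound[OF assms])
  also have "\<dots> = K * tail_const"
    unfolding tail_const_def by (rule suminf_mult[OF summable_tail])
  finally show ?thesis .
qed

lemma branch_nonneg:
  assumes "\<And>t. t \<in> {0..p} \<Longrightarrow> 0 \<le> H t"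
  shows "0 \<le> branch H s"
  using assms[OF wrap_in[of "1/s"]] chi_nonneg
  by (auto simp: branch_def intro!: divide_nonneg_nonneg mult_nonneg_nonneg)

lemma branch_linear: "branch (\<lambda>t. a * H t + b * G t) s = a * branch H s + b * branch G s"
  by (simp add: branch_def algebra_simps add_divide_distrib)

lemma transfer_linear:
  assumes "\<And>t. t \<in> {0..p} \<Longrightarrow> \<bar>H t\<bar> \<le> K" "\<And>t. t \<in> {0..p} \<Longrightarrow> \<bar>G t\<bar> \<le> K'" "0 \<le> t"
  shows "transfer (\<lambda>t. a * H t + b * G t) t = a * transfer H t + b * transfer G t"
proof -
  have s: "summable (\<lambda>j. branch H (t + real (Suc j) * p))" "summable (\<lambda>j. branch G (t + real (Suc j) * p))"
    by (rule summable_branch assms | assumption)+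
  show ?thesis
    unfolding transfer_def branch_linear suminf_mult[OF s(1), symmetric] suminf_mult[OF s(2), symmetric]
    by (intro suminf_add[symmetric] summable_mult s)
qed

lemma transfer_measurable [measurable]:
  assumes [measurable]: "H \<in> borel_measurable borel"
  shows "transfer H \<in> borel_measurable borel"
  unfolding transfer_def branch_def by measurable

text \<open>Lipschitz constants are measured against \<open>V\<close>, which has slope 2 on \<open>[1 - p, 1/2]\<close> and slope 1
  elsewhere. For the Euclidean metric the bound for \<open>lip_transfer\<close> would tend to \<open>\<zeta>(4) > 1\<close> as
  \<open>p \<rightarrow> 1\<close>; the points where the map is nearly isometric are sent into the part with slope 2.\<close>

definition V :: "real \<Rightarrow> real" where
  "V t = t + max 0 (min (t - (1 - p)) (p - 1/2))"

lemma V_diff_ge: "x \<le> y \<Longrightarrow> y - x \<le> V y - V x"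
  and V_diff_le: "x \<le> y \<Longrightarrow> V y - V x \<le> 2 * (y - x)"
  and V_low: "x \<le> 1 - p \<Longrightarrow> V x = x"
  and V_mid: "1 - p \<le> x \<Longrightarrow> x \<le> 1/2 \<Longrightarrow> V x = 2 * x - (1 - p)"
  and V_high: "1/2 \<le> x \<Longrightarrow> V x = x + (p - 1/2)"
  using p_gt by (auto simp: V_def)

section \<open>Lipschitz estimates and the Lasota-Yorke inequality\<close>

definition lip :: "real \<Rightarrow> (real \<Rightarrow> real) \<Rightarrow> bool" where
  "lip M H \<longleftrightarrow> (\<forall>x\<in>{0..p}. \<forall>y\<in>{0..p}. x \<le> y \<longrightarrow> \<bar>H x - H y\<bar> \<le> M * (V y - V x))"

text \<open>Wrapping moves [p,1] onto [0,1-p], and \<open>V\<close> has slope 1 on both, so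
  increments of \<open>V\<close> survive the shift. Across \<open>p\<close> the two pieces are
  joined by \<open>H 0 = H p\<close>.\<close>

lemma lip_wrap:
  assumes "lip M H" "H 0 = H p" "0 \<le> x" "x \<le> y" "y \<le> 1"
  shows "\<bar>H (wrap x) - H (wrap y)\<bar> \<le> M * (V y - V x)"
proof -
  have L: "\<bar>H u - H v\<bar> \<le> M * (V v - V u)" if "0 \<le> u" "u \<le> v" "v \<le> p" for u v
    using assms(1) that by (auto simp: lip_def)
  have sh: "V (v - p) - V (u - p) = V v - V u" if "p \<le> u" "p \<le> v" "u \<le> 1" "v \<le> 1" for u v
    using that p_gt by (simp add: V_low V_high)
  consider "y \<le> p" | "p < x" | "x \<le> p" "p < y" by linarith
  then show ?thesis
  proof cases
    case 1 then show ?thesis using L[of x y] assms by (simp add: wrap_def)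
  next
    case 2 then show ?thesis using L[of "x - p" "y - p"] sh[of x y] assms p_gt by (simp add: wrap_def)
  next
    case 3
    have "\<bar>H x - H p\<bar> \<le> M * (V p - V x)" "\<bar>H 0 - H (y - p)\<bar> \<le> M * (V y - V p)"
      using L[of x p] L[of 0 "y - p"] sh[of p y] 3 assms p_gt by auto
    then show ?thesis using 3 assms(2) by (simp add: wrap_def right_diff_distrib)
  qed
qed

text \<open>Product rule in the variable u = 1/s. The variation of \<open>H\<close> carries u^2 from
  the Jacobian and another u^2 from u - u' \<le> (s' - s) u^2, hence the factor 1/s^4 for
  \<open>M\<close>; the variation of the weight chi(u) u^2 is charged to the supremum bound
  \<open>K\<close>. The slope of \<open>V\<close> at the inverted points is bounded by
  \<open>\<sigma>\<close>.\<close>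

lemma branch_diff:
  assumes H: "lip M H" "H 0 = H p" and K: "\<And>t. t \<in> {0..p} \<Longrightarrow> \<bar>H t\<bar> \<le> K" and M: "0 \<le> M"
    and s: "1 \<le> s" "s \<le> s'"
    and slope: "V (1/s) - V (1/s') \<le> \<sigma> * (1/s - 1/s')" "0 \<le> \<sigma>"
  shows "\<bar>branch H s - branch H s'\<bar> \<le> (M * \<sigma> / s^4 + K * (1/r + 2) / s\<^sup>2) * (s' - s)"
proof -
  define u u' where "u = 1/s" and "u' = 1/s'"
  have u: "0 < u'" "u' \<le> u" "u \<le> 1" using s by (auto simp: u_def u'_def divide_simps)
  have K0: "0 \<le> K" using K[of 0] p_pos by force
  \<comment> \<open>At t = 1, where \<open>branch\<close> is 0 by definition, the formula still
    holds because \<open>chi 1 = 0\<close>.\<close>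
  have br: "branch H t = chi (1/t) * H (wrap (1/t)) * (1/t)\<^sup>2" if "1 \<le> t" for t
    using that chi_eq_0[of 1] r_le by (auto simp: branch_def power_divide)
  have d: "u - u' = (s' - s) * (u * u')" using s by (simp add: u_def u'_def field_simps)
  have "u * u' \<le> u\<^sup>2" using u by (simp add: power2_eq_square)
  then have d2: "u - u' \<le> (s' - s) * u\<^sup>2" unfolding d using s by (intro mult_left_mono) auto
  define E E' where "E = H (wrap u)" and "E' = H (wrap u')"
  have E: "\<bar>E\<bar> \<le> K" unfolding E_def by (rule K, rule wrap_in) (use u in auto)
  have "\<bar>E' - E\<bar> \<le> M * (V u - V u')"
    unfolding E_def E'_def by (rule lip_wrap) (use H u in auto)
  also have "\<dots> \<le> M * (\<sigma> * ((s' - s) * u\<^sup>2))"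
    using slope d2 M u unfolding u_def[symmetric] u'_def[symmetric]
    by (intro mult_left_mono) (auto intro: order_trans mult_left_mono)
  finally have EE: "\<bar>E - E'\<bar> \<le> M * (\<sigma> * ((s' - s) * u\<^sup>2))" by (simp add: abs_minus_commute)
  have "\<bar>chi u * u\<^sup>2 - chi u' * u'\<^sup>2\<bar> = \<bar>(chi u - chi u') * u\<^sup>2 + chi u' * ((u + u') * (u - u'))\<bar>"
    by (simp add: algebra_simps power2_eq_square)
  also have "\<dots> \<le> \<bar>chi u - chi u'\<bar> * u\<^sup>2 + chi u' * ((u + u') * (u - u'))"
    by (rule order_trans[OF abs_triangle_ineq]) (use u chi_nonneg[of u'] in \<open>auto simp: abs_mult\<close>)
  also have "\<dots> \<le> ((u - u') / r) * 1 + 1 * (2 * (u - u'))"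
    using chi_lipschitz[of u u'] u r_pos chi_nonneg chi_le_1
    by (intro add_mono mult_mono) (auto simp: power_le_one)
  also have "\<dots> = (1/r + 2) * (u - u')" by (simp add: algebra_simps)
  also have "\<dots> \<le> (1/r + 2) * ((s' - s) * u\<^sup>2)" using d2 r_pos by (intro mult_left_mono) auto
  finally have W: "\<bar>chi u * u\<^sup>2 - chi u' * u'\<^sup>2\<bar> \<le> (1/r + 2) * ((s' - s) * u\<^sup>2)" .
  have "\<bar>branch H s - branch H s'\<bar> = \<bar>(chi u * u\<^sup>2 - chi u' * u'\<^sup>2) * E + chi u' * u'\<^sup>2 * (E - E')\<bar>"
    using s by (simp add: br u_def u'_def E_def E'_def algebra_simps)
  also have "\<dots> \<le> \<bar>chi u * u\<^sup>2 - chi u' * u'\<^sup>2\<bar> * \<bar>E\<bar> + chi u' * u'\<^sup>2 * \<bar>E - E'\<bar>"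
    by (rule order_trans[OF abs_triangle_ineq]) (use chi_nonneg[of u'] in \<open>auto simp: abs_mult\<close>)
  also have "\<dots> \<le> (1/r + 2) * ((s' - s) * u\<^sup>2) * K + 1 * u\<^sup>2 * (M * (\<sigma> * ((s' - s) * u\<^sup>2)))"
    using W E EE u s r_pos chi_nonneg chi_le_1 K0 by (intro add_mono mult_mono power_mono) auto
  also have "\<dots> = (M * \<sigma> * u^4 + K * (1/r + 2) * u\<^sup>2) * (s' - s)"
    by (simp add: distrib_left distrib_right power4_eq_xxxx power2_eq_square mult_ac)
  finally show ?thesis by (simp add: u_def power_divide)
qed

text \<open>The first branch contributes \<open>b\<close> to the coefficient of \<open>M\<close>.
  For the others the worst slope 2 of \<open>V\<close> is used: s \<ge> (z + i) p and p^4 \<ge> 1/4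
  give 2/s^4 \<le> 8/(z + i)^4, and these sum to at most 8/(3 (z - 1/2)^3).\<close>

lemma zone_bound:
  assumes H: "lip M H" "H 0 = H p" and K: "\<And>t. t \<in> {0..p} \<Longrightarrow> \<bar>H t\<bar> \<le> K" and M: "0 \<le> M"
    and x: "0 \<le> x" "x \<le> y" "(z - 2) * p \<le> x" and z: "2 \<le> z"
    and first: "\<bar>branch H (x + p) - branch H (y + p)\<bar> \<le> (M * b + K * (1/r + 2) / p\<^sup>2) * (y - x)"
    and b: "b + 8 / (3 * (z - 1/2)^3) \<le> c"
  shows "\<bar>transfer H x - transfer H y\<bar> \<le> (M * c + K * (1/r + 2) * tail_const) * (y - x)"
proof -
  have K0: "0 \<le> K" using K[of 0] p_pos by force
  define B where "B j = (case j of 0 \<Rightarrow> b | Suc i \<Rightarrow> 8 * (1 / (z + real i)^4))" for j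
  define q where "q j = 1 / (real (Suc j) * p)\<^sup>2" for j
  define N where "N = K * (1/r + 2)"
  have N0: "0 \<le> N" using K0 r_pos by (simp add: N_def)
  have sB': "summable (\<lambda>j. B (Suc j))"
    unfolding B_def nat.case using sums_inverse_fourth_le(1)[of z] z by (intro summable_mult) auto
  then have sB: "summable B" by (simp add: summable_Suc_iff)
  have "(\<Sum>j. B (Suc j)) \<le> 8 * (1 / (3 * (z - 1/2)^3))"
    unfolding B_def nat.case using sums_inverse_fourth_le[of z] z
    by (subst suminf_mult) auto
  then have Bc: "suminf B \<le> c"
    using suminf_split_head[OF sB] b by (simp add: B_def)
  have sq: "summable q" unfolding q_def by (rule summable_tail)
  have qs: "suminf q = tail_const" unfolding q_def tail_const_def ..
  have tm: "\<bar>branch H (x + real (Suc j) * p) - branch H (y + real (Suc j) * p)\<bar>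
      \<le> (M * B j + N * q j) * (y - x)" for j
  proof (cases j)
    case 0
    then show ?thesis using first by (simp add: B_def q_def N_def)
  next
    case (Suc i)
    define s where "s = x + real (Suc j) * p"
    \<comment> \<open>From the second branch on, s \<ge> 2p > 1, so \<open>branch_diff\<close>
      applies wherever \<open>x\<close> lies.\<close>
    have "real (Suc j) * p \<ge> 2 * p" unfolding Suc using p_pos by (intro mult_right_mono) auto
    then have s1: "1 \<le> s" unfolding s_def using x p_gt by linarith
    have sz: "(z + real i) * p \<le> s" unfolding s_def Suc using x by (simp add: algebra_simps)
    have zi: "0 < z + real i" using z by simp
    have "V (1/s) - V (1/(y + real (Suc j) * p)) \<le> 2 * (1/s - 1/(y + real (Suc j) * p))"
      using s1 x unfolding s_def by (intro V_diff_le divide_left_mono mult_pos_pos) auto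
    then have "\<bar>branch H s - branch H (y + real (Suc j) * p)\<bar>
        \<le> (M * 2 / s^4 + N / s\<^sup>2) * (y + real (Suc j) * p - s)"
      unfolding N_def using s1 x by (intro branch_diff H K M) (auto simp: s_def)
    also have "\<dots> = (M * 2 / s^4 + N / s\<^sup>2) * (y - x)" by (simp add: s_def)
    also have "\<dots> \<le> (M * B j + N * q j) * (y - x)"
    proof (intro mult_right_mono add_mono)
      have "1/4 \<le> p^4"
        using mult_mono[OF p_sq p_sq] by (simp add: power4_eq_xxxx mult.assoc)
      then have "(z + real i)^4 * (1/4) \<le> (z + real i)^4 * p^4" using zi by (intro mult_left_mono) auto
      also have "\<dots> \<le> s^4" unfolding power_mult_distrib[symmetric] using sz zi p_pos by (intro power_mono) auto
      finally have "2 / s^4 \<le> 2 / ((z + real i)^4 * (1/4))" using zi s1 by (intro divide_left_mono) auto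
      then have "2 / s^4 \<le> B j" by (simp add: B_def Suc)
      then show "M * 2 / s^4 \<le> M * B j" using M by (simp add: mult_left_mono flip: times_divide_eq_right)
      have "real (Suc j) * p \<le> s" using x by (simp add: s_def)
      then have "1 / s\<^sup>2 \<le> q j" unfolding q_def using p_pos s1
        by (intro divide_left_mono power_mono mult_pos_pos zero_less_power) auto
      then show "N / s\<^sup>2 \<le> N * q j" using mult_left_mono[OF _ N0] by fastforce
    qed (use x in auto)
    finally show ?thesis by (simp add: s_def)
  qed
  have sM: "summable (\<lambda>j. (M * B j + N * q j) * (y - x))"
    by (intro summable_mult2 summable_add summable_mult sB sq)
  have sx: "summable (\<lambda>j. branch H (x + real (Suc j) * p))" "summable (\<lambda>j. branch H (y + real (Suc j) * p))"
    by (rule summable_branch[OF K], assumption, use x in simp)+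
  have sd: "summable (\<lambda>j. \<bar>branch H (x + real (Suc j) * p) - branch H (y + real (Suc j) * p)\<bar>)"
    by (rule summable_comparison_test'[OF sM, of 0]) (use tm in auto)
  have "\<bar>transfer H x - transfer H y\<bar> = \<bar>\<Sum>j. branch H (x + real (Suc j) * p) - branch H (y + real (Suc j) * p)\<bar>"
    unfolding transfer_def using suminf_diff[OF sx] by simp
  also have "\<dots> \<le> (\<Sum>j. \<bar>branch H (x + real (Suc j) * p) - branch H (y + real (Suc j) * p)\<bar>)"
    by (rule summable_rabs[OF sd])
  also have "\<dots> \<le> (\<Sum>j. (M * B j + N * q j) * (y - x))"
    by (rule suminf_le[OF tm sd sM])
  also have "\<dots> = (M * suminf B + N * suminf q) * (y - x)"
    using sB sq by (simp add: suminf_mult2[symmetric] suminf_add[symmetric] suminf_mult summable_mult summable_add)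
  also have "\<dots> \<le> (M * c + N * tail_const) * (y - x)"
    using Bc M x qs N0 by (intro mult_right_mono add_mono mult_left_mono) auto
  finally show ?thesis by (simp add: N_def)
qed

text \<open>Since x + p < 2, the inverted points lie in [1/2,1], where \<open>V\<close> has slope 1;
  the first branch thus avoids the factor 2.\<close>

lemma branch_diff_first:
  assumes H: "lip M H" "H 0 = H p" and K: "\<And>t. t \<in> {0..p} \<Longrightarrow> \<bar>H t\<bar> \<le> K" and M: "0 \<le> M"
    and x: "0 \<le> x" "x \<le> y" "y \<le> p" and s: "1 \<le> s0" "s0 \<le> x + p" "1 / s0^4 \<le> b"
  shows "\<bar>branch H (x + p) - branch H (y + p)\<bar> \<le> (M * b + K * (1/r + 2) / p\<^sup>2) * (y - x)"
proof -
  have K0: "0 \<le> K" using K[of 0] p_pos by force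
  have "1/2 \<le> 1 / (x + p)" "1/2 \<le> 1 / (y + p)" using s x p_less_1 by (auto simp: divide_simps)
  then have "\<bar>branch H (x + p) - branch H (y + p)\<bar>
      \<le> (M * 1 / (x + p)^4 + K * (1/r + 2) / (x + p)\<^sup>2) * ((y + p) - (x + p))"
    using s x by (intro branch_diff H K M) (auto simp: V_high)
  also have "\<dots> \<le> (M * b + K * (1/r + 2) / p\<^sup>2) * ((y + p) - (x + p))"
  proof (intro mult_right_mono add_mono)
    have "1 / (x + p)^4 \<le> 1 / s0^4" using s by (intro divide_left_mono power_mono) auto
    then show "M * 1 / (x + p)^4 \<le> M * b"
      using s M mult_left_mono[of "1 / (x + p)^4" b M] by simp
    show "K * (1/r + 2) / (x + p)\<^sup>2 \<le> K * (1/r + 2) / p\<^sup>2"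
      using K0 r_pos p_pos x by (intro divide_left_mono power_mono mult_pos_pos zero_less_power mult_nonneg_nonneg) auto
  qed (use x in auto)
  finally show ?thesis by simp
qed

text \<open>Lasota-Yorke inequality: the old Lipschitz constant is contracted by 9/10, the rest
  depends on the supremum only. The circle is cut at 1 - p and 1/2, and the three estimates are
  glued because increments of \<open>V\<close> add up.\<close>

lemma lip_transfer:
  assumes H: "lip M H" "H 0 = H p" and K: "\<And>t. t \<in> {0..p} \<Longrightarrow> \<bar>H t\<bar> \<le> K" and M: "0 \<le> M"
  shows "lip (9/10 * M + K * (1/r + 2) * tail_const) (transfer H)"
proof -
  define N where "N = K * (1/r + 2) * tail_const"
  have K0: "0 \<le> K" using K[of 0] p_pos by force
  then have N0: "0 \<le> N" using tail_const_nonneg r_pos by (simp add: N_def)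
  define P where "P x y \<longleftrightarrow> \<bar>transfer H x - transfer H y\<bar> \<le> (9/10 * M + N) * (V y - V x)" for x y
  have trans: "P x z" if "P x y" "P y z" for x y z
    using that unfolding P_def by (simp add: right_diff_distrib)
  have up: "P x y" if "\<bar>transfer H x - transfer H y\<bar> \<le> (M * c + N) * (y - x)"
    "c * (y - x) \<le> 9/10 * (V y - V x)" "x \<le> y" for x y c
  proof -
    have "(M * c + N) * (y - x) = M * (c * (y - x)) + N * (y - x)" by (simp add: algebra_simps)
    also have "\<dots> \<le> M * (9/10 * (V y - V x)) + N * (V y - V x)"
      using that M N0 V_diff_ge[of x y] by (intro add_mono mult_left_mono) auto
    finally show ?thesis using that(1) by (simp add: P_def algebra_simps)
  qed
  \<comment> \<open>Here x + p \<le> 1, so the first branch vanishes; the others give 64/81 <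
    9/10.\<close>
  have low: "P x y" if "0 \<le> x" "x \<le> y" "y \<le> 1 - p" for x y
  proof (rule up)
    show "\<bar>transfer H x - transfer H y\<bar> \<le> (M * (9/10) + N) * (y - x)"
      unfolding N_def
      by (rule zone_bound[where z = 2 and b = 0], rule H, rule H, rule K, assumption, rule M)
         (use that r_pos K0 in \<open>auto simp: branch_def power3_eq_cube\<close>)
  qed (use that in \<open>auto simp: V_low\<close>)
  \<comment> \<open>The nearly isometric first branch adds 1. The total 1 + 64/81 < 9/5 is
    acceptable since \<open>V\<close> has slope 2 here.\<close>
  have mid: "P x y" if "1 - p \<le> x" "x \<le> y" "y \<le> 1/2" for x y
  proof (rule up)
    show "\<bar>transfer H x - transfer H y\<bar> \<le> (M * (9/5) + N) * (y - x)"
      unfolding N_def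
      by (rule zone_bound[where z = 2 and b = 1], rule H, rule H, rule K, assumption, rule M)
         (use that p_gt p_less_1 in \<open>auto simp: power3_eq_cube intro!: branch_diff_first[where ?s0.0 = 1 and b = 1, OF H K M, simplified]\<close>)
  qed (use that in \<open>auto simp: V_mid\<close>)
  \<comment> \<open>Now x + p \<ge> 12/10 with 1/(12/10)^4 < 1/2, and x \<ge> p/2 permits z = 5/2:
    the total is 1/2 + 1/3 < 9/10.\<close>
  have high: "P x y" if "1/2 \<le> x" "x \<le> y" "y \<le> p" for x y
  proof (rule up)
    show "\<bar>transfer H x - transfer H y\<bar> \<le> (M * (9/10) + N) * (y - x)"
      unfolding N_def
      by (rule zone_bound[where z = "5/2" and b = "1/2"], rule H, rule H, rule K, assumption, rule M)
         (use that p_gt p_less_1 in \<open>auto simp: power3_eq_cube power4_eq_xxxx intro!: branch_diff_first[where ?s0.0 = "12/10" and b = "1/2", OF H K M, simplified]\<close>)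
  qed (use that in \<open>auto simp: V_high\<close>)
  have half: "1 - p \<le> 1/2" "1/2 \<le> p" using p_gt by auto
  have lowmid: "P x y" if "0 \<le> x" "x \<le> y" "y \<le> 1/2" for x y
  proof -
    consider "y \<le> 1 - p" | "1 - p \<le> x" | "x \<le> 1 - p" "1 - p \<le> y" by linarith
    then show ?thesis
      using that half by cases (blast intro: low, blast intro: mid, rule trans[of _ "1 - p"], auto intro: low mid)
  qed
  have "P x y" if "0 \<le> x" "x \<le> y" "y \<le> p" for x y
  proof -
    consider "y \<le> 1/2" | "1/2 \<le> x" | "x \<le> 1/2" "1/2 \<le> y" by linarith
    then show ?thesis
      using that half by cases (blast intro: lowmid, blast intro: high, rule trans[of _ "1/2"], auto intro: lowmid high)
  qed
  then show ?thesis by (auto simp: lip_def P_def N_def)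
qed

subsection \<open>Invariant densities\<close>

text \<open>Density on (0,1) of the random lift of the density \<open>H\<close> on the
  circle.\<close>

definition density_on :: "(real \<Rightarrow> real) \<Rightarrow> real \<Rightarrow> real" where
  "density_on H t = chi t * H (wrap t) * indicator {0<..<1} t"

lemma density_measurable [measurable]:
  assumes [measurable]: "H \<in> borel_measurable borel"
  shows "density_on H \<in> borel_measurable borel"
  unfolding density_on_def by measurable

lemma density_nonneg: "(\<And>t. t \<in> {0..p} \<Longrightarrow> 0 \<le> H t) \<Longrightarrow> 0 \<le> density_on H t"
  using wrap_in[of t] chi_nonneg by (auto simp: density_on_def indicator_def)

text \<open>A periodic function does not distinguish the lifts \<open>t\<close> and
  \<open>t + p\<close>, whose weights add up to 1 by \<open>chi_partition\<close>.\<close>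

lemma nn_integral_density_periodic:
  fixes \<phi> :: "real \<Rightarrow> ennreal"
  assumes [measurable]: "H \<in> borel_measurable borel" "\<phi> \<in> borel_measurable borel"
    and H: "\<And>t. t \<in> {0..p} \<Longrightarrow> 0 \<le> H t" and \<phi>: "\<And>t. \<phi> (t + p) = \<phi> t"
  shows "(\<integral>\<^sup>+t. density_on H t * \<phi> t \<partial>lborel) = (\<integral>\<^sup>+t. H t * \<phi> t * indicator {0..<p} t \<partial>lborel)"
proof -
  define F where "F t = ennreal (chi t * H t) * \<phi> t * indicator {0..<p} t" for t
  define G where "G t = ennreal (chi (t + p) * H t) * \<phi> t * indicator {0..<p} t" for t
  have [measurable]: "F \<in> borel_measurable borel" "G \<in> borel_measurable borel"
    unfolding F_def G_def by measurable
  \<comment> \<open>\<open>F\<close> is the part of the lift on [0,p), and \<open>G\<close> is the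
    part beyond \<open>p\<close>, moved back by \<open>p\<close>.\<close>
  have "(\<integral>\<^sup>+t. density_on H t * \<phi> t \<partial>lborel) = (\<integral>\<^sup>+t. F t + G (-p + 1 * t) \<partial>lborel)"
  proof (rule nn_integral_cong_AE)
    have *: "ennreal (density_on H t) * \<phi> t = F t + G (-p + 1 * t)" if t: "t \<noteq> 0" "t \<noteq> p" for t
    proof -
      have ph: "\<phi> (t - p) = \<phi> t" using \<phi>[of "t - p"] by simp
      consider "t < 0" | "0 < t" "t < p" | "p < t" "t < 1" | "1 \<le> t" using t by linarith
      then show ?thesis
      proof cases
        case 4
        then have "chi t = 0" using r_le by (intro chi_eq_0) auto
        then show ?thesis using 4 p_less_1 by (simp add: F_def G_def density_on_def)
      qed (use p_gt p_less_1 in \<open>auto simp: F_def G_def density_on_def wrap_def ph indicator_def\<close>)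
    qed
    show "AE t in lborel. ennreal (density_on H t) * \<phi> t = F t + G (-p + 1 * t)"
      using AE_lborel_singleton[of 0] AE_lborel_singleton[of p] by eventually_elim (rule *)
  qed
  also have "\<dots> = (\<integral>\<^sup>+t. F t \<partial>lborel) + (\<integral>\<^sup>+t. G (-p + 1 * t) \<partial>lborel)"
    by (rule nn_integral_add) measurable
  also have "(\<integral>\<^sup>+t. G (-p + 1 * t) \<partial>lborel) = (\<integral>\<^sup>+t. G t \<partial>lborel)"
    by (subst nn_integral_real_affine[where c = 1 and t = "-p"]) auto
  also have "(\<integral>\<^sup>+t. F t \<partial>lborel) + \<dots> = (\<integral>\<^sup>+t. F t + G t \<partial>lborel)"
    by (rule nn_integral_add[symmetric]) measurable
  also have "\<dots> = (\<integral>\<^sup>+t. H t * \<phi> t * indicator {0..<p} t \<partial>lborel)"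
  proof (rule nn_integral_cong)
    fix t
    show "F t + G t = H t * \<phi> t * indicator {0..<p} t"
    proof (cases "t \<in> {0..<p}")
      case True
      then have "ennreal (chi t * H t) + ennreal (chi (t + p) * H t) = ennreal (chi t * H t + chi (t + p) * H t)"
        using H[of t] chi_nonneg by (intro ennreal_plus[symmetric]) auto
      also have "chi t * H t + chi (t + p) * H t = H t"
        using chi_partition[of t] True by (simp flip: distrib_right)
      finally show ?thesis using True by (simp add: F_def G_def flip: distrib_right)
    qed (simp add: F_def G_def)
  qed
  finally show ?thesis .
qed

text \<open>Substituting t = 1/s turns the density into \<open>branch H\<close>, and folding modulo
  \<open>p\<close> turns that into \<open>transfer H\<close>. This identifies
  \<open>transfer\<close> as the transfer operator of lift followed by inversion.\<close>

lemma nn_integral_density_inverse: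
  fixes \<phi> :: "real \<Rightarrow> ennreal"
  assumes [measurable]: "H \<in> borel_measurable borel" "\<phi> \<in> borel_measurable borel"
    and H: "\<And>t. t \<in> {0..p} \<Longrightarrow> 0 \<le> H t" and K: "\<And>t. t \<in> {0..p} \<Longrightarrow> \<bar>H t\<bar> \<le> K"
    and \<phi>: "\<And>t. \<phi> (t + p) = \<phi> t"
  shows "(\<integral>\<^sup>+t. density_on H t * \<phi> (1/t) \<partial>lborel) = (\<integral>\<^sup>+t. transfer H t * \<phi> t * indicator {0..<p} t \<partial>lborel)"
proof -
  have [measurable]: "branch H \<in> borel_measurable borel" unfolding branch_def by measurable
  have per: "\<phi> (t + real n * p) = \<phi> t" for t n
  proof (induction n)
    case (Suc n)
    then show ?case using \<phi>[of "t + real n * p"] by (simp add: algebra_simps)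
  qed simp
  have "(\<integral>\<^sup>+t. density_on H t * \<phi> (1/t) \<partial>lborel)
      = (\<integral>\<^sup>+t. (ennreal (density_on H t) * \<phi> (1/t)) * indicator {0<..<1} t \<partial>lborel)"
    by (intro nn_integral_cong) (auto simp: density_on_def indicator_def)
  also have "\<dots> = (\<integral>\<^sup>+s. (ennreal (density_on H (1/s)) * \<phi> (1/(1/s))) * ennreal (1/s\<^sup>2) * indicator {1<..} s \<partial>lborel)"
    by (rule nn_integral_inversion[symmetric]) measurable
  also have "\<dots> = (\<integral>\<^sup>+s. (ennreal (branch H s) * \<phi> s) * indicator {p..} s \<partial>lborel)"
  proof (rule nn_integral_cong)
    fix s
    show "(ennreal (density_on H (1/s)) * \<phi> (1/(1/s))) * ennreal (1/s\<^sup>2) * indicator {1<..} s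
        = (ennreal (branch H s) * \<phi> s) * indicator {p..} s"
    proof (cases "1 < s")
      case True
      have d: "0 \<le> density_on H (1/s)" by (rule density_nonneg[OF H])
      have "ennreal (density_on H (1/s) * (1/s\<^sup>2)) = ennreal (density_on H (1/s)) * ennreal (1/s\<^sup>2)"
        using d by (intro ennreal_mult) auto
      then have "ennreal (density_on H (1/s)) * \<phi> s * ennreal (1/s\<^sup>2) = ennreal (density_on H (1/s) * (1/s\<^sup>2)) * \<phi> s"
        by (simp only: mult_ac)
      moreover have "density_on H (1/s) * (1/s\<^sup>2) = branch H s"
        using True by (simp add: density_on_def branch_def)
      ultimately show ?thesis using True p_less_1 by simp
    qed (auto simp: branch_def)
  qed
  also have "\<dots> = (\<integral>\<^sup>+t. (\<Sum>j. ennreal (branch H (t + real (Suc j) * p)) * \<phi> (t + real (Suc j) * p)) * indicator {0..<p} t \<partial>lborel)"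
    by (rule nn_integral_periodize) (use p_pos in \<open>simp_all\<close>)
  also have "\<dots> = (\<integral>\<^sup>+t. transfer H t * \<phi> t * indicator {0..<p} t \<partial>lborel)"
  proof (rule nn_integral_cong)
    fix t
    show "(\<Sum>j. ennreal (branch H (t + real (Suc j) * p)) * \<phi> (t + real (Suc j) * p)) * indicator {0..<p} t
        = transfer H t * \<phi> t * indicator {0..<p} t"
    proof (cases "t \<in> {0..<p}")
      case True
      have "(\<Sum>j. ennreal (branch H (t + real (Suc j) * p))) = ennreal (transfer H t)"
        unfolding transfer_def using True by (intro suminf_ennreal2 branch_nonneg H summable_branch[OF K]) auto
      then show ?thesis unfolding per by (simp add: ennreal_suminf_multc)
    qed simp
  qed
  finally show ?thesis .
qed

section \<open>A class of Lipschitz probability densities stable under the transfer operator\<close>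

text \<open>The condition \<open>H 0 = H p\<close> expresses continuity on the circle.\<close>

definition good :: "real \<Rightarrow> (real \<Rightarrow> real) \<Rightarrow> bool" where
  "good M H \<longleftrightarrow> H \<in> borel_measurable borel \<and> (\<forall>t\<in>{0..p}. 0 \<le> H t) \<and> H 0 = H p \<and> lip M H
     \<and> integral {0..p} H = 1"

lemma lip_imp_lipschitz:
  assumes "lip M H" "0 \<le> M" "x \<in> {0..p}" "y \<in> {0..p}"
  shows "\<bar>H x - H y\<bar> \<le> 2 * M * \<bar>x - y\<bar>"
proof -
  have *: "\<bar>H x - H y\<bar> \<le> 2 * M * (y - x)" if "x \<in> {0..p}" "y \<in> {0..p}" "x \<le> y" for x y
  proof -
    have "\<bar>H x - H y\<bar> \<le> M * (V y - V x)" using assms that by (auto simp: lip_def)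
    also have "\<dots> \<le> M * (2 * (y - x))" using assms that by (intro mult_left_mono V_diff_le)
    finally show ?thesis by (simp add: algebra_simps)
  qed
  show ?thesis using *[of x y] *[of y x] assms by (cases "x \<le> y") (auto simp: abs_minus_commute)
qed

lemma lip_continuous:
  assumes "lip M H" "0 \<le> M"
  shows "continuous_on {0..p} H"
  by (rule lipschitz_on_continuous_on[where L = "2 * M"], rule lipschitz_onI)
     (use assms lip_imp_lipschitz in \<open>auto simp: dist_real_def\<close>)

text \<open>On an interval of length \<open>d\<close> containing \<open>x\<close> the density is at
  least H x - 2Md, and its integral there is at most 1. Keeping \<open>d\<close> free lets the
  coefficient of \<open>M\<close> be made small in \<open>good_invariant\<close>.\<close>

lemma good_sup_bound:
  assumes g: "good M H" and M: "0 \<le> M" and d: "0 < d" "d \<le> p/2" and x: "x \<in> {0..p}"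
  shows "\<bar>H x\<bar> \<le> 1/d + 2 * M * d"
proof -
  have l: "lip M H" and int: "integral {0..p} H = 1" and pos: "\<And>t. t \<in> {0..p} \<Longrightarrow> 0 \<le> H t"
    using g by (auto simp: good_def)
  have cont: "continuous_on {0..p} H" by (rule lip_continuous[OF l M])
  \<comment> \<open>The interval extends to the right or to the left of \<open>x\<close>, whichever
    fits into [0,p].\<close>
  obtain a where a: "0 \<le> a" "a + d \<le> p" "a \<le> x" "x \<le> a + d"
  proof (cases "x \<le> p/2")
    case True then show ?thesis using that[of x] x d by auto
  next
    case False then show ?thesis using that[of "x - d"] x d by auto
  qed
  have near: "H x - 2 * M * d \<le> H y" if y: "y \<in> {a..a+d}" for y
  proof -
    have "\<bar>H x - H y\<bar> \<le> 2 * M * \<bar>x - y\<bar>"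
      using l M x y a by (intro lip_imp_lipschitz) auto
    also have "\<dots> \<le> 2 * M * d" using M a y by (intro mult_left_mono) auto
    finally show ?thesis by linarith
  qed
  have "integral {a..a+d} (\<lambda>_. H x - 2 * M * d) \<le> integral {a..a+d} H"
    by (rule integral_le) (use near a in \<open>auto intro!: integrable_continuous_real continuous_on_subset[OF cont]\<close>)
  also have "\<dots> \<le> integral {0..p} H"
    by (rule integral_subset_le)
       (use a pos in \<open>auto intro!: integrable_continuous_real continuous_on_subset[OF cont]\<close>)
  finally have "d * (H x - 2 * M * d) \<le> 1" using d int by simp
  then have "H x \<le> 1/d + 2 * M * d" using d by (simp add: field_simps)
  then show ?thesis using pos[OF x] by simp
qed

lemma good_bounded:
  assumes "good M H" "0 \<le> M"
  shows "\<exists>K. \<forall>t\<in>{0..p}. \<bar>H t\<bar> \<le> K"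
  using good_sup_bound[OF assms, of "p/2"] p_pos by (intro exI[of _ "1/(p/2) + 2 * M * (p/2)"]) auto

text \<open>The two series differ by a shift of index and the term \<open>branch H p\<close>, which
  is 0 because p < 1.\<close>

lemma transfer_endpoints:
  assumes K: "\<And>t. t \<in> {0..p} \<Longrightarrow> \<bar>H t\<bar> \<le> K"
  shows "transfer H 0 = transfer H p"
proof -
  have s: "summable (\<lambda>j. branch H (0 + real (Suc j) * p))" by (rule summable_branch[OF K]) auto
  have "transfer H 0 = branch H p + (\<Sum>j. branch H (real (Suc (Suc j)) * p))"
    unfolding transfer_def using suminf_split_head[OF s] by simp
  also have "branch H p = 0" using p_less_1 by (simp add: branch_def)
  finally show ?thesis by (simp add: transfer_def algebra_simps)
qed

lemma good_transfer:
  assumes g: "good M H" and M: "0 \<le> M" and K: "\<And>t. t \<in> {0..p} \<Longrightarrow> \<bar>H t\<bar> \<le> K"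
    and M': "9/10 * M + K * (1/r + 2) * tail_const \<le> M"
  shows "good M (transfer H)"
proof -
  have [measurable]: "H \<in> borel_measurable borel" and pos: "\<And>t. t \<in> {0..p} \<Longrightarrow> 0 \<le> H t"
    and e: "H 0 = H p" and l: "lip M H" and int: "integral {0..p} H = 1"
    using g by (auto simp: good_def)
  have "lip (9/10 * M + K * (1/r + 2) * tail_const) (transfer H)"
    by (rule lip_transfer[OF l e K M])
  then have l': "lip M (transfer H)"
    unfolding lip_def using M' V_diff_ge
    by (smt (verit, ccfv_threshold) mult_right_mono)
  have tp: "0 \<le> transfer H t" if "t \<in> {0..p}" for t
    unfolding transfer_def using that by (intro suminf_nonneg summable_branch[OF K] branch_nonneg pos) auto
  \<comment> \<open>Mass is preserved: both integral formulas are applied with the constant test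
    function 1.\<close>
  have "((\<integral>\<^sup>+t. ennreal (transfer H t) * indicator {0..p} t \<partial>lborel)) = (\<integral>\<^sup>+t. transfer H t * (\<lambda>_. 1 :: ennreal) t * indicator {0..<p} t \<partial>lborel)"
    by (intro nn_integral_cong_AE) (use AE_lborel_singleton[of p] in \<open>eventually_elim, auto simp: indicator_def\<close>)
  also have "\<dots> = (\<integral>\<^sup>+t. density_on H t * (\<lambda>_. 1 :: ennreal) (1/t) \<partial>lborel)"
    by (rule nn_integral_density_inverse[symmetric]) (use pos K in auto)
  also have "\<dots> = (\<integral>\<^sup>+t. H t * (\<lambda>_. 1 :: ennreal) t * indicator {0..<p} t \<partial>lborel)"
    by (rule nn_integral_density_periodic) (use pos in auto)
  also have "\<dots> = (\<integral>\<^sup>+t. ennreal (H t) * indicator {0..p} t \<partial>lborel)"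
    by (intro nn_integral_cong_AE) (use AE_lborel_singleton[of p] in \<open>eventually_elim, auto simp: indicator_def\<close>)
  finally have eq: "(\<integral>\<^sup>+t. ennreal (transfer H t) * indicator {0..p} t \<partial>lborel) = (\<integral>\<^sup>+t. ennreal (H t) * indicator {0..p} t \<partial>lborel)" .
  have "integral\<^sup>N lborel (\<lambda>t. ennreal (transfer H t) * indicator {0..p} t) = ennreal (integral {0..p} (transfer H))"
    by (rule nn_integral_has_integral_lebesgue'[OF tp])
       (auto intro!: integrable_integral integrable_continuous_real lip_continuous[OF l' M])
  moreover have "integral\<^sup>N lborel (\<lambda>t. ennreal (H t) * indicator {0..p} t) = ennreal (integral {0..p} H)"
    by (rule nn_integral_has_integral_lebesgue'[OF pos])
       (auto intro!: integrable_integral integrable_continuous_real lip_continuous[OF l M])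
  moreover have "0 \<le> integral {0..p} (transfer H)"
    by (rule integral_nonneg) (auto intro!: tp integrable_continuous_real lip_continuous[OF l' M])
  ultimately have "integral {0..p} (transfer H) = 1" using eq int by simp
  then show ?thesis
    using tp l' transfer_endpoints[OF K] by (auto simp: good_def)
qed

text \<open>With \<open>C\<close> the constant multiplying the supremum, \<open>d\<close> is chosen
  so that 2Cd \<le> 1/20, and then \<open>M\<close> so that C/d = M/20. The new constant is at most
  (9/10 + 1/20 + 1/20) M.\<close>

lemma good_invariant:
  obtains M where "0 \<le> M" "\<And>H. good M H \<Longrightarrow> good M (transfer H)"
proof -
  define C where "C = (1/r + 2) * tail_const"
  have C: "0 \<le> C" using r_pos tail_const_nonneg by (simp add: C_def)
  define d where "d = min (p/2) (1 / (40 * (C + 1)))"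
  have d: "0 < d" "d \<le> p/2" using p_pos C by (auto simp: d_def)
  have "d * (40 * (C + 1)) \<le> 1" using C by (auto simp: d_def min_def field_simps)
  then have Cd: "40 * (C * d) \<le> 1" using d by (simp add: algebra_simps)
  define M where "M = 20 * C / d"
  have M: "0 \<le> M" using C d by (simp add: M_def)
  show thesis
  proof (rule that[OF M])
    fix H assume g: "good M H"
    show "good M (transfer H)"
    proof (rule good_transfer[OF g M])
      show "\<bar>H t\<bar> \<le> 1/d + 2 * M * d" if "t \<in> {0..p}" for t
        by (rule good_sup_bound[OF g M d that])
      have "(1/d + 2 * M * d) * (1/r + 2) * tail_const = C / d + M * (40 * (C * d)) / 20"
        by (simp add: C_def) (simp add: algebra_simps add_divide_distrib)
      also have "\<dots> \<le> C / d + M * 1 / 20"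
        using M Cd by (intro add_left_mono divide_right_mono mult_left_mono) auto
      also have "C / d = M / 20" by (simp add: M_def)
      finally show "9/10 * M + (1/d + 2 * M * d) * (1/r + 2) * tail_const \<le> M" by linarith
    qed
  qed
qed

section \<open>Existence of an invariant density\<close>

lemma transfer_cong:
  assumes "\<And>t. t \<in> {0..p} \<Longrightarrow> H t = G t"
  shows "transfer H t = transfer G t"
proof -
  have "branch H s = branch G s" for s
    using assms[OF wrap_in[of "1/s"]] by (auto simp: branch_def)
  then show ?thesis by (simp add: transfer_def)
qed

text \<open>Continuity in the supremum norm, used to pass to the limit in the invariance
  equation.\<close>

lemma transfer_diff_le:
  assumes "\<And>t. t \<in> {0..p} \<Longrightarrow> \<bar>H t\<bar> \<le> K" "\<And>t. t \<in> {0..p} \<Longrightarrow> \<bar>G t\<bar> \<le> K'"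
    and "\<And>t. t \<in> {0..p} \<Longrightarrow> \<bar>H t - G t\<bar> \<le> e" "0 \<le> t"
  shows "\<bar>transfer H t - transfer G t\<bar> \<le> e * tail_const"
proof -
  have "transfer (\<lambda>t. 1 * H t + (-1) * G t) t = 1 * transfer H t + (-1) * transfer G t"
    by (rule transfer_linear[OF assms(1,2,4)])
  moreover have "\<bar>transfer (\<lambda>t. 1 * H t + (-1) * G t) t\<bar> \<le> e * tail_const"
    by (rule transfer_bound) (use assms(3,4) in auto)
  ultimately show ?thesis by simp
qed

lemma transfer_sum:
  fixes n :: nat
  assumes "\<And>i t. t \<in> {0..p} \<Longrightarrow> \<bar>H i t\<bar> \<le> K" "0 \<le> t"
  shows "transfer (\<lambda>t. \<Sum>i<n. H i t) t = (\<Sum>i<n. transfer (H i) t)"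
proof (induction n)
  case 0
  have "branch (\<lambda>t. 0) s = 0" for s by (simp add: branch_def)
  then show ?case by (simp add: transfer_def)
next
  case (Suc n)
  have "transfer (\<lambda>t. 1 * (\<Sum>i<n. H i t) + 1 * H n t) t = 1 * transfer (\<lambda>t. \<Sum>i<n. H i t) t + 1 * transfer (H n) t"
  proof (rule transfer_linear[where K = "real n * K" and K' = K])
    show "\<bar>\<Sum>i<n. H i t\<bar> \<le> real n * K" if "t \<in> {0..p}" for t
      using sum_norm_bound[of "{..<n}" "\<lambda>i. H i t" K] assms(1)[OF that] by simp
  qed (use assms in auto)
  then show ?case using Suc by simp
qed

text \<open>Krylov-Bogolyubov argument: the Cesaro means \<open>A n\<close> of the iterates of the
  uniform density stay in the class \<open>good M\<close>, hence are equi-Lipschitz, and they are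
  almost invariant. A uniform limit of a subsequence is invariant.\<close>

lemma invariant_density_exists:
  "\<exists>H M. 0 \<le> M \<and> good M H \<and> (\<forall>t\<in>{0..p}. transfer H t = H t)"
proof -
  obtain M where M: "0 \<le> M" and inv: "\<And>H. good M H \<Longrightarrow> good M (transfer H)"
    using good_invariant by blast
  define h where "h k = (transfer ^^ k) (\<lambda>_. 1/p)" for k
  have "good M (\<lambda>_. 1/p)"
    using p_pos M V_diff_ge by (auto simp: good_def lip_def intro!: mult_nonneg_nonneg)
       (metis diff_ge_0_iff_ge order_trans)
  then have h: "good M (h k)" for k by (induction k) (auto simp: h_def inv)
  define K where "K = 1/(p/2) + 2 * M * (p/2)"
  have K: "\<bar>G t\<bar> \<le> K" if "good M G" "t \<in> {0..p}" for G t
    unfolding K_def by (rule good_sup_bound[OF that(1) M]) (use p_pos that in auto)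
  define A where "A n t = (\<Sum>k<Suc n. h k t) / real (Suc n)" for n t
  have cont: "continuous_on {0..p} G" if "good M G" for G
    using that by (intro lip_continuous[OF _ M]) (auto simp: good_def)
  have gA: "good M (A n)" for n
    unfolding good_def
  proof (intro conjI ballI)
    note g = h[unfolded good_def]
    have [measurable]: "h k \<in> borel_measurable borel" for k using g by blast
    show "A n \<in> borel_measurable borel" unfolding A_def by measurable
    show "0 \<le> A n t" if "t \<in> {0..p}" for t
      unfolding A_def using g that by (intro divide_nonneg_nonneg sum_nonneg) auto
    show "A n 0 = A n p" unfolding A_def using g by simp
    show "lip M (A n)" unfolding lip_def
    proof (intro ballI impI)
      fix x y assume xy: "x \<in> {0..p}" "y \<in> {0..p}" "x \<le> y"
      have "\<bar>\<Sum>k<Suc n. h k x - h k y\<bar> \<le> real (Suc n) * (M * (V y - V x))"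
        using sum_norm_bound[of "{..<Suc n}" "\<lambda>k. h k x - h k y" "M * (V y - V x)"] g xy
        by (auto simp: lip_def)
      moreover have "A n x - A n y = (\<Sum>k<Suc n. h k x - h k y) / real (Suc n)"
        unfolding A_def by (simp add: sum_subtractf diff_divide_distrib)
      ultimately show "\<bar>A n x - A n y\<bar> \<le> M * (V y - V x)"
        by (simp add: abs_divide divide_le_eq mult.commute del: sum.lessThan_Suc)
    qed
    have "integral {0..p} (A n) = (\<Sum>k<Suc n. integral {0..p} (h k)) / real (Suc n)"
      unfolding A_def using integrable_continuous_real[OF cont[OF h]]
      by (simp add: integral_sum del: sum.lessThan_Suc of_nat_Suc)
    then show "integral {0..p} (A n) = 1" using g by simp
  qed
  have near: "\<bar>transfer (A n) t - A n t\<bar> \<le> 2 * K / real (Suc n)" if t: "t \<in> {0..p}" for n t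
  proof -
    have bd: "\<bar>\<Sum>k<Suc n. h k t\<bar> \<le> real (Suc n) * K" if "t \<in> {0..p}" for t
      using sum_norm_bound[of "{..<Suc n}" "\<lambda>k. h k t" K] K[OF h that] by simp
    have "transfer (A n) t = transfer (\<lambda>t. (1 / real (Suc n)) * (\<Sum>k<Suc n. h k t) + 0 * (\<Sum>k<Suc n. h k t)) t"
      by (rule transfer_cong) (simp add: A_def del: sum.lessThan_Suc)
    also have "\<dots> = (1 / real (Suc n)) * transfer (\<lambda>t. \<Sum>k<Suc n. h k t) t + 0 * transfer (\<lambda>t. \<Sum>k<Suc n. h k t) t"
      by (rule transfer_linear[OF bd bd]) (use t in auto)
    also have "transfer (\<lambda>t. \<Sum>k<Suc n. h k t) t = (\<Sum>k<Suc n. h (Suc k) t)"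
      using transfer_sum[where H = h and K = K and t = t and n = "Suc n", OF K[OF h]] t by (simp add: h_def del: sum.lessThan_Suc)
    finally have "transfer (A n) t = (1 / real (Suc n)) * (\<Sum>k<Suc n. h (Suc k) t)" by (simp del: sum.lessThan_Suc)
    moreover have "A n t = (\<Sum>k<Suc n. h k t) / real (Suc n)" by (simp only: A_def)
    ultimately have "transfer (A n) t - A n t = ((\<Sum>k<Suc n. h (Suc k) t) - (\<Sum>k<Suc n. h k t)) / real (Suc n)"
      by (simp add: diff_divide_distrib del: sum.lessThan_Suc)
    \<comment> \<open>The sums over the iterates and over their images telescope, leaving only two
      bounded terms.\<close>
    also have "\<dots> = (h (Suc n) t - h 0 t) / real (Suc n)"
      using sum_lessThan_telescope[of "\<lambda>k. h k t" "Suc n"] by (simp only: sum_subtractf[symmetric])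
    finally have "\<bar>transfer (A n) t - A n t\<bar> = \<bar>h (Suc n) t - h 0 t\<bar> / real (Suc n)" by simp
    also have "\<dots> \<le> 2 * K / real (Suc n)"
      using K[OF h t, of "Suc n"] K[OF h t, of 0] by (intro divide_right_mono) auto
    finally show ?thesis .
  qed
  have lipA: "\<bar>A n x - A n y\<bar> \<le> 2 * M * \<bar>x - y\<bar>" if "x \<in> {0..p}" "y \<in> {0..p}" for n x y
    by (rule lip_imp_lipschitz[OF _ M that]) (use gA in \<open>simp add: good_def\<close>)
  obtain g and k :: "nat \<Rightarrow> nat" where g: "continuous_on {0..p} g" and k: "strict_mono k"
    and lim: "\<And>e. 0 < e \<Longrightarrow> \<exists>N. \<forall>n x. n \<ge> N \<and> x \<in> {0..p} \<longrightarrow> norm (A (k n) x - g x) < e"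
  proof (rule Arzela_Ascoli[of "{0..p}" A K])
    show "norm (A n x) \<le> K" if "x \<in> {0..p}" for n x using K[OF gA that] by simp
    fix x e :: real assume x: "x \<in> {0..p}" and e: "0 < e"
    show "\<exists>d>0. \<forall>n y. y \<in> {0..p} \<and> norm (x - y) < d \<longrightarrow> norm (A n x - A n y) < e"
    proof (intro exI[of _ "e / (2 * M + 1)"] conjI allI impI)
      fix n y assume y: "y \<in> {0..p} \<and> norm (x - y) < e / (2 * M + 1)"
      have "norm (A n x - A n y) \<le> 2 * M * \<bar>x - y\<bar>" using lipA x y by simp
      also have "\<dots> \<le> (2 * M + 1) * \<bar>x - y\<bar>" by (simp add: algebra_simps)
      also have "\<dots> < e" using y M by (simp add: less_divide_eq mult.commute)
      finally show "norm (A n x - A n y) < e" .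
    qed (use e M in simp)
  qed auto
  \<comment> \<open>The limit is controlled on [0,p] only; extending it by constants makes it
    continuous, hence Borel, on the whole line.\<close>
  define H where "H t = g (max 0 (min p t))" for t
  have Hg: "H t = g t" if "t \<in> {0..p}" for t using that by (simp add: H_def)
  have tend: "(\<lambda>n. A (k n) t) \<longlonglongrightarrow> H t" if "t \<in> {0..p}" for t
    unfolding LIMSEQ_iff Hg[OF that] using lim that by blast
  have "continuous_on UNIV H"
    unfolding H_def using p_pos by (intro continuous_on_compose2[OF g] continuous_intros) auto
  then have meas: "H \<in> borel_measurable borel" by (rule borel_measurable_continuous_onI)
  have unif: "uniform_limit {0..p} (\<lambda>n. A (k n)) H sequentially"
    unfolding uniform_limit_iff eventually_sequentially dist_norm using lim Hg by fastforce
  have HK: "\<bar>H t\<bar> \<le> K" if "t \<in> {0..p}" for t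
    by (rule LIMSEQ_le_const2[OF tendsto_rabs[OF tend[OF that]]]) (use K[OF gA that] in auto)
  have "good M H"
    unfolding good_def
  proof (intro conjI ballI meas)
    note gg = gA[unfolded good_def]
    show "0 \<le> H t" if "t \<in> {0..p}" for t
      by (rule LIMSEQ_le_const[OF tend[OF that]]) (use gg that in auto)
    have "(\<lambda>n. A (k n) 0) = (\<lambda>n. A (k n) p)" using gg by auto
    then show "H 0 = H p" using tend[of 0] tend[of p] p_pos LIMSEQ_unique by auto
    show "lip M H" unfolding lip_def
    proof (intro ballI impI)
      fix x y assume xy: "x \<in> {0..p}" "y \<in> {0..p}" "x \<le> y"
      show "\<bar>H x - H y\<bar> \<le> M * (V y - V x)"
        by (rule LIMSEQ_le_const2[OF tendsto_rabs[OF tendsto_diff[OF tend[OF xy(1)] tend[OF xy(2)]]]])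
           (use gg xy in \<open>auto simp: lip_def\<close>)
    qed
    obtain I J where IJ: "\<And>n. (A (k n) has_integral I n) {0..p}" "(H has_integral J) {0..p}" "I \<longlonglongrightarrow> J"
      by (rule uniform_limit_integral[OF unif cont[OF gA]]) auto
    have "I n = 1" for n using integral_unique[OF IJ(1)[of n]] gg[of "k n"] by simp
    then have "I = (\<lambda>_. 1)" by auto
    then have "J = 1" using IJ(3) by (simp add: LIMSEQ_const_iff)
    then show "integral {0..p} H = 1" using IJ(2) by (simp add: integral_unique)
  qed
  moreover have "transfer H t = H t" if t: "t \<in> {0..p}" for t
  proof -
    have "(\<lambda>n. transfer (A (k n)) t) \<longlonglongrightarrow> transfer H t"
      unfolding LIMSEQ_iff
    proof (intro allI impI)
      fix e :: real assume e: "0 < e"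
      then have "0 < e / (tail_const + 1)" using tail_const_nonneg by simp
      then obtain N where N: "\<And>n x. n \<ge> N \<Longrightarrow> x \<in> {0..p} \<Longrightarrow> norm (A (k n) x - g x) < e / (tail_const + 1)"
        using lim by blast
      have "norm (transfer (A (k n)) t - transfer H t) < e" if "n \<ge> N" for n
      proof -
        have "\<bar>transfer (A (k n)) t - transfer H t\<bar> \<le> e / (tail_const + 1) * tail_const"
          by (rule transfer_diff_le[OF K[OF gA] HK]) (use N[OF that] Hg t in \<open>auto intro: less_imp_le\<close>)
        also have "\<dots> < e" using e tail_const_nonneg by (simp add: field_simps)
        finally show ?thesis by simp
      qed
      then show "\<exists>N. \<forall>n\<ge>N. norm (transfer (A (k n)) t - transfer H t) < e" by blast
    qed
    then have "(\<lambda>n. transfer (A (k n)) t - A (k n) t) \<longlonglongrightarrow> transfer H t - H t"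
      by (intro tendsto_diff tend t)
    moreover have "(\<lambda>n. transfer (A (k n)) t - A (k n) t) \<longlonglongrightarrow> 0"
    proof (rule Lim_null_comparison)
      have "(\<lambda>n. 2 * K / real (Suc n)) \<longlonglongrightarrow> 0" by real_asymp
      then show "(\<lambda>n. 2 * K / real (Suc (k n))) \<longlonglongrightarrow> 0"
        using LIMSEQ_subseq_LIMSEQ[OF _ k, of "\<lambda>n. 2 * K / real (Suc n)"] by (simp add: o_def)
      show "\<forall>\<^sub>F n in sequentially. norm (transfer (A (k n)) t - A (k n) t) \<le> 2 * K / real (Suc (k n))"
        using near[OF t] by simp
    qed
    ultimately have "transfer H t - H t = 0" by (rule LIMSEQ_unique)
    then show ?thesis by simp
  qed
  ultimately show ?thesis using M by blast
qed

section \<open>Positivity of invariant densities\<close>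

text \<open>A point \<open>u\<close> of (0,p] is its own lift with positive probability, so one term
  of the series for \<open>transfer H t\<close> is positive and the others are nonnegative.\<close>

lemma invariant_positive_step:
  assumes K: "\<And>t. t \<in> {0..p} \<Longrightarrow> \<bar>H t\<bar> \<le> K" and H: "\<And>t. t \<in> {0..p} \<Longrightarrow> 0 \<le> H t"
    and inv: "\<And>t. t \<in> {0..p} \<Longrightarrow> transfer H t = H t"
    and u: "0 < u" "u \<le> p" "0 < H u" and t: "t \<in> {0..p}" "t + real (Suc j) * p = 1 / u"
  shows "0 < H t"
proof -
  have "1 < 1 / u" "1 / (1 / u) = u" using u p_less_1 by (auto simp: less_divide_eq)
  then have "0 < branch H (t + real (Suc j) * p)"
    unfolding t(2) branch_def using u chi_pos[of u] r_pos by (simp add: wrap_def)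
  then have "0 < transfer H t"
    unfolding transfer_def using t(1) by (intro suminf_pos2[of _ j] summable_branch[OF K] branch_nonneg H) auto
  then show ?thesis using inv t by simp
qed

text \<open>Inversion expands intervals inside \<open>[0,p]\<close> by at least \<open>1/p\<^sup>2 > 1\<close>, so the images of an
  interval eventually hit a multiple of \<open>p\<close>.\<close>

lemma invariant_positive_near_0:
  assumes K: "\<And>t. t \<in> {0..p} \<Longrightarrow> \<bar>H t\<bar> \<le> K" and H: "\<And>t. t \<in> {0..p} \<Longrightarrow> 0 \<le> H t"
    and inv: "\<And>t. t \<in> {0..p} \<Longrightarrow> transfer H t = H t"
    and "0 \<le> c" "d \<le> p" "\<And>t. c < t \<Longrightarrow> t < d \<Longrightarrow> 0 < H t" "p * (p\<^sup>2)^n < d - c"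
  shows "\<exists>\<delta>>0. \<forall>t. 0 < t \<and> t < \<delta> \<longrightarrow> 0 < H t"
  using assms(4-7)
proof (induction n arbitrary: c d)
  case 0
  \<comment> \<open>An interval longer than \<open>p\<close> cannot lie in [0,p].\<close>
  then show ?case by simp
next
  case (Suc n)
  note step = invariant_positive_step[OF K H inv]
  have cd: "c < d" using Suc.prems(4) p_pos by (smt (verit) zero_less_power mult_pos_pos)
  show ?case
  proof (cases "c = 0")
    case True
    then show ?thesis using Suc.prems(3) cd by blast
  next
    case False
    then have c: "0 < c" using Suc.prems by simp
    \<comment> \<open>The cell [kp, (k+1)p) is the one containing 1/d, the left end of the image of
      (c,d) under inversion.\<close>
    define q where "q = 1 / d / p"
    define k where "k = nat \<lfloor>q\<rfloor>"
    have d1: "1 < 1 / d" using c cd Suc.prems p_less_1 by (simp add: less_divide_eq)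
    have "1 * p \<le> 1 / d" using d1 p_less_1 by linarith
    then have "1 \<le> q" unfolding q_def using p_pos by (subst le_divide_eq) auto
    then have k1: "1 \<le> k" and k: "real k \<le> q" "q < real k + 1"
      by (auto simp: k_def le_nat_iff le_floor_iff)
    have "1 / d = q * p" using p_pos by (simp add: q_def)
    then have kp: "real k * p \<le> 1 / d" "1 / d < (real k + 1) * p" using k p_pos by auto
    \<comment> \<open>Positivity passes from (c,d) to all residues of its inverted image; the shift
      \<open>m - 1\<close> matches the \<open>Suc j\<close> in \<open>step\<close>.\<close>
    have pull: "0 < H t" if t: "t \<in> {0..p}" and m: "1 \<le> m" and s: "1 / d < t + real m * p" "t + real m * p < 1 / c" for t m
    proof -
      define u where "u = 1 / (t + real m * p)"
      define w where "w = t + real m * p"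
      have "0 < w" using s d1 unfolding w_def by linarith
      then have u: "c < u" "u < d" using s c cd unfolding u_def w_def[symmetric] by (auto simp: field_simps)
      show ?thesis
        by (rule step[of u _ "m - 1"]) (use \<open>0 < w\<close>[unfolded w_def] u c Suc.prems t m in \<open>auto simp: u_def of_nat_diff\<close>)
    qed
    show ?thesis
    proof (cases "(real k + 1) * p < 1 / c")
      case True
      \<comment> \<open>The image passes the multiple (k+1)p, so it covers points just to its right,
        whose residues fill an interval starting at 0.\<close>
      have "0 < H t" if "0 < t" "t < min p (1 / c - (real k + 1) * p)" for t
        by (rule pull[of _ "Suc k"]) (use that kp in \<open>auto simp: algebra_simps\<close>)
      then show ?thesis using True p_pos by (intro exI[of _ "min p (1 / c - (real k + 1) * p)"]) auto
    next
      case False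
      show ?thesis
      \<comment> \<open>The image stays in one cell; translated back, it is an interval of length (d
        - c)/(cd) \<ge> (d - c)/p^2.\<close>
      proof (rule Suc.IH)
        show "0 \<le> 1 / d - real k * p" using kp by simp
        show "1 / c - real k * p \<le> p" using False by (simp add: algebra_simps)
        show "0 < H t" if "1 / d - real k * p < t" "t < 1 / c - real k * p" for t
          by (rule pull[of _ k]) (use that kp k1 False in \<open>auto simp: algebra_simps\<close>)
        have "c * d \<le> p\<^sup>2" unfolding power2_eq_square using c cd Suc.prems by (intro mult_mono) auto
        have "p * (p\<^sup>2) ^ n * p\<^sup>2 < d - c" using Suc.prems(4) by (simp add: mult_ac)
        then have "p * (p\<^sup>2) ^ n < (d - c) / p\<^sup>2" using p_pos by (simp add: less_divide_eq)
        also have "\<dots> \<le> (d - c) / (c * d)"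
          using \<open>c * d \<le> p\<^sup>2\<close> c cd p_pos by (intro divide_left_mono) auto
        also have "\<dots> = (1 / c - real k * p) - (1 / d - real k * p)"
          using c cd by (simp add: field_simps)
        finally show "p * (p\<^sup>2) ^ n < (1 / c - real k * p) - (1 / d - real k * p)" .
      qed
    qed
  qed
qed

text \<open>Total mass 1 and continuity give an interval of positivity, hence positivity near 0.
  Every \<open>t\<close> is the residue of some 1/u with \<open>u\<close> arbitrarily close to
  0.\<close>

lemma invariant_positive:
  assumes g: "good M H" and M: "0 \<le> M" and inv: "\<And>t. t \<in> {0..p} \<Longrightarrow> transfer H t = H t"
    and t: "t \<in> {0..p}"
  shows "0 < H t"
proof -
  have H: "\<And>t. t \<in> {0..p} \<Longrightarrow> 0 \<le> H t" and l: "lip M H" and int: "integral {0..p} H = 1"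
    using g by (auto simp: good_def)
  obtain K where K: "\<And>t. t \<in> {0..p} \<Longrightarrow> \<bar>H t\<bar> \<le> K" using good_bounded[OF g M] by blast
  have cont: "continuous_on {0..p} H" by (rule lip_continuous[OF l M])
  obtain t0 where t0: "t0 \<in> {0..p}" "0 < H t0"
  proof (rule ccontr)
    assume no: "\<not> thesis"
    have "H x = 0" if "x \<in> {0..p}" for x
      using that H[OF that] no by (meson not_less order_antisym \<open>\<And>t0. t0 \<in> {0..p} \<Longrightarrow> 0 < H t0 \<Longrightarrow> thesis\<close>)
    then have "integral {0..p} H = integral {0..p} (\<lambda>_. 0)" by (intro integral_cong) auto
    then show False using int by simp
  qed
  then obtain e where e: "0 < e" "\<And>x. x \<in> {0..p} \<Longrightarrow> dist x t0 < e \<Longrightarrow> dist (H x) (H t0) < H t0"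
    using cont unfolding continuous_on_iff by meson
  define c d where "c = max 0 (t0 - e)" and "d = min p (t0 + e)"
  have cd: "0 \<le> c" "c < d" "d \<le> p" using t0 e p_pos by (auto simp: c_def d_def)
  have pos: "0 < H x" if "c < x" "x < d" for x
  proof -
    have "\<bar>H x - H t0\<bar> < H t0" using e(2)[of x] that by (auto simp: c_def d_def dist_real_def)
    then show ?thesis by linarith
  qed
  have "p\<^sup>2 < 1" using p_pos p_less_1 by (simp add: power_less_one_iff)
  then obtain n where "(p\<^sup>2)^n < d - c" using real_arch_pow_inv[of "d - c" "p\<^sup>2"] cd by auto
  moreover have "p * (p\<^sup>2)^n \<le> 1 * (p\<^sup>2)^n" using p_less_1 by (intro mult_right_mono) auto
  ultimately have n: "p * (p\<^sup>2)^n < d - c" by linarith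
  obtain \<delta> where \<delta>: "0 < \<delta>" "\<And>x. 0 < x \<Longrightarrow> x < \<delta> \<Longrightarrow> 0 < H x"
    using invariant_positive_near_0[OF K H inv cd(1) cd(3) pos n] by blast
  obtain j :: nat where j: "1 / (min \<delta> p * p) < real j" using reals_Archimedean2 by blast
  define u where "u = 1 / (t + real (Suc j) * p)"
  have mp: "0 < min \<delta> p" using \<delta> p_pos by simp
  have "1 < (min \<delta> p * p) * real j" using j mp p_pos by (simp add: divide_less_eq mult_ac)
  also have "\<dots> \<le> min \<delta> p * (t + real (Suc j) * p)"
    using mp p_pos t by (simp add: algebra_simps)
  finally have u1: "1 < min \<delta> p * (t + real (Suc j) * p)" .
  then have den: "0 < t + real (Suc j) * p" using mp by (metis less_trans zero_less_one zero_less_mult_pos)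
  then have u: "0 < u" "u < min \<delta> p" using u1 unfolding u_def by (simp_all only: divide_less_eq zero_less_divide_1_iff if_True)
  show ?thesis
    by (rule invariant_positive_step[OF K H inv, of u t j]) (use u \<delta> t in \<open>auto simp: u_def\<close>)
qed

section \<open>Invariance as equality of images modulo the period\<close>

definition residue :: "real \<Rightarrow> real" where
  "residue t = p * frac (t / p)"

lemma residue_measurable [measurable]: "residue \<in> borel_measurable borel"
  unfolding residue_def frac_def by measurable

lemma residue_periodic: "residue (t + p) = residue t"
  using p_pos by (simp add: residue_def add_divide_distrib frac_def)

text \<open>For a Borel set \<open>A\<close>, the indicator of \<open>A\<close> composed with
  \<open>residue\<close> is periodic. Integrating it against the two images gives \<open>H\<close>
  and \<open>transfer H\<close> respectively, which agree.\<close>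

lemma distr_residue_inverse:
  assumes g: "good M H" and M: "0 \<le> M" and inv: "\<And>t. t \<in> {0..p} \<Longrightarrow> transfer H t = H t"
  shows "distr (density lborel (density_on H)) borel residue
       = distr (density lborel (density_on H)) borel (\<lambda>t. residue (1/t))"
proof (rule measure_eqI)
  have [measurable]: "H \<in> borel_measurable borel" and H: "\<And>t. t \<in> {0..p} \<Longrightarrow> 0 \<le> H t"
    using g by (auto simp: good_def)
  obtain K where K: "\<And>t. t \<in> {0..p} \<Longrightarrow> \<bar>H t\<bar> \<le> K" using good_bounded[OF g M] by blast
  fix A assume "A \<in> sets (distr (density lborel (density_on H)) borel residue)"
  then have [measurable]: "A \<in> sets borel" by simp
  define \<phi> :: "real \<Rightarrow> ennreal" where "\<phi> t = indicator A (residue t)" for t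
  have [measurable]: "\<phi> \<in> borel_measurable borel" unfolding \<phi>_def by measurable
  have per: "\<phi> (t + p) = \<phi> t" for t by (simp add: \<phi>_def residue_periodic)
  have "emeasure (distr (density lborel (density_on H)) borel residue) A = (\<integral>\<^sup>+t. density_on H t * \<phi> t \<partial>lborel)"
    by (simp add: emeasure_distr emeasure_density \<phi>_def indicator_def of_bool_def vimage_def)
  also have "\<dots> = (\<integral>\<^sup>+t. H t * \<phi> t * indicator {0..<p} t \<partial>lborel)"
    by (rule nn_integral_density_periodic) (use H per in auto)
  also have "\<dots> = (\<integral>\<^sup>+t. transfer H t * \<phi> t * indicator {0..<p} t \<partial>lborel)"
    by (intro nn_integral_cong) (auto simp: indicator_def inv)
  also have "\<dots> = (\<integral>\<^sup>+t. density_on H t * \<phi> (1/t) \<partial>lborel)"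
    by (rule nn_integral_density_inverse[symmetric]) (use H K per in auto)
  also have "\<dots> = emeasure (distr (density lborel (density_on H)) borel (\<lambda>t. residue (1/t))) A"
    by (simp add: emeasure_distr emeasure_density \<phi>_def indicator_def of_bool_def vimage_def)
  finally show "emeasure (distr (density lborel (density_on H)) borel residue) A
      = emeasure (distr (density lborel (density_on H)) borel (\<lambda>t. residue (1/t))) A" .
qed simp

text \<open>A periodic function factors through \<open>residue\<close>, so equality of image
  measures extends to complex integrands such as characters.\<close>

lemma integral_density_inverse:
  fixes e :: "real \<Rightarrow> complex"
  assumes g: "good M H" and M: "0 \<le> M" and inv: "\<And>t. t \<in> {0..p} \<Longrightarrow> transfer H t = H t"
    and [measurable]: "e \<in> borel_measurable borel" and e: "\<And>t (k::int). e (t + of_int k * p) = e t"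
  shows "integral\<^sup>L (density lborel (density_on H)) e = integral\<^sup>L (density lborel (density_on H)) (\<lambda>t. e (1/t))"
proof -
  have [measurable]: "H \<in> borel_measurable borel" using g by (auto simp: good_def)
  have res: "e (residue t) = e t" for t
    using e[of t "- \<lfloor>t / p\<rfloor>"] p_pos by (simp add: residue_def frac_def algebra_simps)
  have "integral\<^sup>L (density lborel (density_on H)) e = integral\<^sup>L (distr (density lborel (density_on H)) borel residue) e"
    by (subst integral_distr) (auto simp: res)
  also have "\<dots> = integral\<^sup>L (distr (density lborel (density_on H)) borel (\<lambda>t. residue (1/t))) e"
    by (rule arg_cong[OF distr_residue_inverse[OF g M inv]])
  also have "\<dots> = integral\<^sup>L (density lborel (density_on H)) (\<lambda>t. e (1/t))"
    by (subst integral_distr) (auto simp: res)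
  finally show ?thesis .
qed

lemma emeasure_density_UNIV:
  assumes g: "good M H" and M: "0 \<le> M"
  shows "emeasure (density lborel (density_on H)) UNIV = 1"
proof -
  have [measurable]: "H \<in> borel_measurable borel" and H: "\<And>t. t \<in> {0..p} \<Longrightarrow> 0 \<le> H t"
    and l: "lip M H" and int: "integral {0..p} H = 1"
    using g by (auto simp: good_def)
  have "emeasure (density lborel (density_on H)) UNIV = (\<integral>\<^sup>+t. density_on H t * (\<lambda>_. 1 :: ennreal) t \<partial>lborel)"
    by (simp add: emeasure_density)
  also have "\<dots> = (\<integral>\<^sup>+t. H t * (\<lambda>_. 1 :: ennreal) t * indicator {0..<p} t \<partial>lborel)"
    by (rule nn_integral_density_periodic) (use H in auto)
  also have "\<dots> = (\<integral>\<^sup>+t. ennreal (H t) * indicator {0..p} t \<partial>lborel)"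
    by (intro nn_integral_cong_AE) (use AE_lborel_singleton[of p] in \<open>eventually_elim, auto simp: indicator_def\<close>)
  also have "\<dots> = ennreal (integral {0..p} H)"
    by (rule nn_integral_has_integral_lebesgue'[OF H])
       (auto intro!: integrable_integral integrable_continuous_real lip_continuous[OF l M])
  finally show ?thesis by (simp add: int)
qed

text \<open>Both \<open>chi\<close> and \<open>H\<close> are positive there. Together with
  \<open>chi_eq_0\<close> this makes p + r the exact right end of the support, which tells different
  values of \<open>r\<close> apart.\<close>

lemma emeasure_density_interval_pos:
  assumes g: "good M H" and M: "0 \<le> M" and inv: "\<And>t. t \<in> {0..p} \<Longrightarrow> transfer H t = H t"
    and ab: "0 < a" "a < b" "b \<le> p + r"
  shows "0 < emeasure (density lborel (density_on H)) {a<..<b}"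
proof -
  have [measurable]: "H \<in> borel_measurable borel" using g by (auto simp: good_def)
  have pos: "0 < density_on H t" if "t \<in> {a<..<b}" for t
    using that ab r_le chi_pos[of t] invariant_positive[OF g M inv wrap_in[of t]]
    by (simp add: density_on_def)
  have "emeasure (density lborel (density_on H)) {a<..<b} \<noteq> 0"
  proof
    assume "emeasure (density lborel (density_on H)) {a<..<b} = 0"
    then have "(\<integral>\<^sup>+t. ennreal (density_on H t) * indicator {a<..<b} t \<partial>lborel) = 0"
      by (simp add: emeasure_density)
    then have "AE t in lborel. ennreal (density_on H t) * indicator {a<..<b} t = 0"
      by (subst (asm) nn_integral_0_iff_AE) auto
    then have "AE t in lborel. t \<notin> {a<..<b}"
      by eventually_elim (use pos in \<open>force simp: indicator_def ennreal_eq_0_iff split: if_splits\<close>)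
    then have "emeasure lborel {a<..<b} = 0" by (subst (asm) AE_iff_measurable[of "{a<..<b}"]) auto
    then show False using ab by simp
  qed
  then show ?thesis by (simp add: zero_less_iff_neq_zero)
qed

end

subsection \<open>Measures on the hyperbola\<close>

text \<open>The supremum over Borel subsets of \<open>A\<close> is attained at the intersection of
  \<open>A\<close> with \<open>S\<close>, which carries all of \<open>M1\<close> and nothing of
  \<open>M2\<close>.\<close>

lemma positive_part_diff_singular:
  fixes M1 M2 :: "'a::topological_space measure"
  assumes M1: "finite_measure M1" "sets M1 = sets borel" and M2: "finite_measure M2" "sets M2 = sets borel"
    and S: "S \<in> sets borel" "emeasure M1 (- S) = 0" "emeasure M2 S = 0"
  shows "positive_part (\<lambda>A. measure M1 A - measure M2 A) = M1"
proof -
  interpret M1: finite_measure M1 by fact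
  interpret M2: finite_measure M2 by fact
  have [simp]: "space M1 = UNIV" using sets_eq_imp_space_eq[OF M1(2)] by simp
  have "positive_part (\<lambda>A. measure M1 A - measure M2 A) = measure_of UNIV (sets borel) (emeasure M1)"
    unfolding positive_part_def
  proof (rule measure_of_eq)
    fix A :: "'a set" assume "A \<in> sigma_sets UNIV (sets borel)"
    then have A: "A \<in> sets borel" using sets.sigma_sets_eq[of "borel :: 'a measure"] by simp
    have "measure M1 (A - S) = 0"
      using emeasure_mono[of "A - S" "- S" M1] S M1 by (simp add: measure_def Diff_eq)
    then have 1: "measure M1 (A \<inter> S) = measure M1 A"
      using M1.finite_measure_Diff'[of A S] A S M1 by simp
    have 2: "measure M2 (A \<inter> S) = 0"
      using emeasure_mono[of "A \<inter> S" S M2] S M2 by (auto simp: measure_def)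
    show "(SUP B\<in>{B \<in> sets borel. B \<subseteq> A}. ennreal (measure M1 B - measure M2 B)) = emeasure M1 A"
    proof (rule antisym)
      show "(SUP B\<in>{B \<in> sets borel. B \<subseteq> A}. ennreal (measure M1 B - measure M2 B)) \<le> emeasure M1 A"
      proof (rule SUP_least)
        fix B assume "B \<in> {B \<in> sets borel. B \<subseteq> A}"
        then have "measure M1 B - measure M2 B \<le> measure M1 A"
          using M1.finite_measure_mono[of B A] A M1(2) measure_nonneg[of M2 B] by (simp add: add_increasing2 diff_le_eq)
        then show "ennreal (measure M1 B - measure M2 B) \<le> emeasure M1 A"
          by (simp add: M1.emeasure_eq_measure ennreal_leI)
      qed
      have "emeasure M1 A = ennreal (measure M1 (A \<inter> S) - measure M2 (A \<inter> S))"
        by (simp add: 1 2 M1.emeasure_eq_measure)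
      also have "\<dots> \<le> (SUP B\<in>{B \<in> sets borel. B \<subseteq> A}. ennreal (measure M1 B - measure M2 B))"
        by (rule SUP_upper) (use A S in auto)
      finally show "emeasure M1 A \<le> (SUP B\<in>{B \<in> sets borel. B \<subseteq> A}. ennreal (measure M1 B - measure M2 B))" .
    qed
  qed simp
  also have "\<dots> = M1" using measure_of_of_measure[of M1] M1(2) by simp
  finally show ?thesis .
qed

lemma positive_part_zero:
  "positive_part (\<lambda>A. 0) = null_measure (borel :: 'a::topological_space measure)"
proof -
  have fin: "finite_measure (null_measure (borel :: 'a measure))"
    by (rule finite_measureI) simp
  have "positive_part (\<lambda>A. measure (null_measure borel) A - measure (null_measure (borel :: 'a measure)) A) = null_measure borel"
    by (rule positive_part_diff_singular[where S = "{}"]) (auto intro: fin)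
  then show ?thesis by simp
qed

lemma complex_measure_integral_diff_singular:
  fixes M1 M2 :: "'a::topological_space measure"
  assumes M1: "finite_measure M1" "sets M1 = sets borel" and M2: "finite_measure M2" "sets M2 = sets borel"
    and S: "S \<in> sets borel" "emeasure M1 (- S) = 0" "emeasure M2 S = 0"
  shows "complex_measure_integral (\<lambda>A. complex_of_real (measure M1 A - measure M2 A)) f
    = integral\<^sup>L M1 f - integral\<^sup>L M2 f"
proof -
  have 1: "positive_part (\<lambda>A. measure M1 A - measure M2 A) = M1"
    by (rule positive_part_diff_singular[OF assms])
  have 2: "positive_part (\<lambda>A. measure M2 A - measure M1 A) = M2"
    by (rule positive_part_diff_singular[OF M2 M1, of "- S"]) (use S in auto)
  show ?thesis
    unfolding complex_measure_integral_def by (simp add: 1 2 positive_part_zero)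
qed

lemma complex_borel_measure_diff:
  fixes M1 M2 :: "'a::topological_space measure"
  assumes M1: "finite_measure M1" "sets M1 = sets borel" and M2: "finite_measure M2" "sets M2 = sets borel"
  shows "complex_borel_measure (\<lambda>A. complex_of_real (measure M1 A - measure M2 A))"
  unfolding complex_borel_measure_def
proof (intro conjI allI impI)
  interpret M1: finite_measure M1 by fact
  interpret M2: finite_measure M2 by fact
  show "complex_of_real (measure M1 A - measure M2 A) = 0" if "A \<notin> sets borel" for A
    using that M1 M2 by (simp add: measure_notin_sets)
  fix A :: "nat \<Rightarrow> 'a set" assume A: "range A \<subseteq> sets borel" "disjoint_family A"
  have "(\<lambda>n. measure M1 (A n) - measure M2 (A n)) sums (measure M1 (\<Union>n. A n) - measure M2 (\<Union>n. A n))"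
    by (intro sums_diff M1.finite_measure_UNION M2.finite_measure_UNION) (use A M1 M2 in auto)
  then show "(\<lambda>n. complex_of_real (measure M1 (A n) - measure M2 (A n))) sums
      complex_of_real (measure M1 (\<Union>n. A n) - measure M2 (\<Union>n. A n))"
    by (simp only: sums_of_real_iff)
qed

section \<open>Arc length and the hyperbola branch\<close>

text \<open>Arc length is a supremum, so it dominates the measure of each single arc; as the speed
  is nonzero, the parameters sent into a null set form a Lebesgue null set.\<close>

lemma AE_notin_null_set_arc_length:
  fixes \<gamma> :: "real \<Rightarrow> real \<times> real"
  assumes arc: "(I, \<gamma>) \<in> regular_arcs \<Gamma>" and [measurable]: "\<gamma> \<in> borel_measurable borel"
    and A: "A \<in> null_sets (arc_length \<Gamma>)"
  shows "A \<in> sets borel" and "AE t in lborel. t \<in> I \<longrightarrow> \<gamma> t \<notin> A"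
proof -
  have st: "sets (arc_length_param J \<delta>) = sets borel" for J \<delta>
    by (simp add: arc_length_param_def)
  have sets: "sets (arc_length \<Gamma>) = sets (borel :: (real \<times> real) measure)"
    unfolding arc_length_def by (rule sets_SUP) (use arc in \<open>auto simp: st\<close>)
  then show [measurable]: "A \<in> sets borel" using A by auto
  have "arc_length_param I \<gamma> \<le> arc_length \<Gamma>"
    unfolding arc_length_def using arc by (auto intro: SUP_upper2[where i = "(I, \<gamma>)"])
  then have "emeasure (arc_length_param I \<gamma>) A \<le> emeasure (arc_length \<Gamma>) A"
    by (rule le_measureD3) (simp add: st sets)
  then have z: "emeasure (arc_length_param I \<gamma>) A = 0" using A by auto
  have I: "open I" and C1: "\<gamma> C1_differentiable_on I" and reg: "\<And>t. t \<in> I \<Longrightarrow> vector_derivative \<gamma> (at t) \<noteq> 0"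
    using arc by (auto simp: regular_arcs_def)
  have [measurable]: "I \<in> sets borel" using I by simp
  have "continuous_on I (\<lambda>t. norm (vector_derivative \<gamma> (at t)))"
    using C1 by (intro continuous_on_norm) (simp add: C1_differentiable_on_eq)
  then have "(\<lambda>t. norm (vector_derivative \<gamma> (at t))) \<in> borel_measurable (restrict_space borel I)"
    by (rule borel_measurable_continuous_on_restrict)
  then have speed[measurable]: "(\<lambda>t. norm (vector_derivative \<gamma> (at t))) \<in> borel_measurable (restrict_space lborel I)"
    by (simp cong: measurable_cong_sets add: sets_restrict_space_cong[of lborel borel])
  have [measurable]: "\<gamma> \<in> restrict_space lborel I \<rightarrow>\<^sub>M borel"
    by (rule measurable_restrict_space1) simp
  have pre: "\<gamma> -` A \<inter> I \<in> sets (restrict_space lborel I)"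
    using measurable_sets[of \<gamma> "restrict_space lborel I" borel A] by (simp add: space_restrict_space)
  have "emeasure (arc_length_param I \<gamma>) A
      = (\<integral>\<^sup>+t. ennreal (norm (vector_derivative \<gamma> (at t))) * indicator (\<gamma> -` A \<inter> I) t \<partial>restrict_space lborel I)"
    unfolding arc_length_param_def using pre
    by (subst emeasure_distr) (auto simp: space_restrict_space emeasure_density)
  then have "AE t in restrict_space lborel I. ennreal (norm (vector_derivative \<gamma> (at t))) * indicator (\<gamma> -` A \<inter> I) t = 0"
    using z pre by (subst nn_integral_0_iff_AE[symmetric]) auto
  then have "AE t in lborel. t \<in> I \<longrightarrow> ennreal (norm (vector_derivative \<gamma> (at t))) * indicator (\<gamma> -` A \<inter> I) t = 0"
    by (subst (asm) AE_restrict_space_iff) auto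
  then show "AE t in lborel. t \<in> I \<longrightarrow> \<gamma> t \<notin> A"
    by eventually_elim (use reg in \<open>auto simp: indicator_def split: if_splits\<close>)
qed

definition hyperbola_arc :: "real \<Rightarrow> real \<Rightarrow> real \<times> real" where
  "hyperbola_arc c t = (c * t, 1 / (c * t))"

text \<open>This is \<open>hyperbola_arc c (1/t)\<close>. For t in (0,1) the two arcs cover the
  parts of the hyperbola left and right of the line x1 = c.\<close>

definition hyperbola_arc_rev :: "real \<Rightarrow> real \<Rightarrow> real \<times> real" where
  "hyperbola_arc_rev c t = (c / t, t / c)"

lemma hyperbola_arc_measurable [measurable]:
  "hyperbola_arc c \<in> borel_measurable borel" "hyperbola_arc_rev c \<in> borel_measurable borel"
  unfolding hyperbola_arc_def hyperbola_arc_rev_def by measurable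

lemma hyperbola_arc_in:
  assumes "0 < c" "0 < t"
  shows "hyperbola_arc c t \<in> hyperbola_plus" "hyperbola_arc_rev c t \<in> hyperbola_plus"
  using assms by (auto simp: hyperbola_arc_def hyperbola_arc_rev_def hyperbola_plus_def)

lemma regular_arcsI:
  assumes "open I" "is_interval I" "\<And>t. t \<in> I \<Longrightarrow> \<gamma> t \<in> \<Gamma>" "inj_on \<gamma> I"
    and "\<And>t. t \<in> I \<Longrightarrow> (\<gamma> has_vector_derivative D t) (at t)" "continuous_on I D" "\<And>t. t \<in> I \<Longrightarrow> D t \<noteq> 0"
  shows "(I, \<gamma>) \<in> regular_arcs \<Gamma>"
proof -
  have "vector_derivative \<gamma> (at t) = D t" if "t \<in> I" for t
    using assms(5)[OF that] by (rule vector_derivative_at)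
  then show ?thesis using assms by (auto simp: regular_arcs_def C1_differentiable_on_def)
qed

lemma hyperbola_arc_regular:
  assumes c: "0 < c"
  shows "({0<..}, hyperbola_arc c) \<in> regular_arcs hyperbola_plus"
proof (rule regular_arcsI[where D = "\<lambda>t. (c, - (1 / (c * t\<^sup>2)))"])
  show "inj_on (hyperbola_arc c) {0<..}"
    using c by (auto simp: inj_on_def hyperbola_arc_def)
  show "(hyperbola_arc c has_vector_derivative (c, - (1 / (c * t\<^sup>2)))) (at t)" if "t \<in> {0<..}" for t
    unfolding hyperbola_arc_def
  proof (rule has_vector_derivative_Pair)
    show "((\<lambda>t. c * t) has_vector_derivative c) (at t)"
      by (auto intro!: derivative_eq_intros simp flip: has_real_derivative_iff_has_vector_derivative)
    show "((\<lambda>t. 1 / (c * t)) has_vector_derivative - (1 / (c * t\<^sup>2))) (at t)"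
      using that c by (auto intro!: derivative_eq_intros simp flip: has_real_derivative_iff_has_vector_derivative
          simp: power2_eq_square)
  qed
qed (use c in \<open>auto intro!: hyperbola_arc_in continuous_intros simp: is_interval_def zero_prod_def\<close>)

lemma hyperbola_arc_rev_regular:
  assumes c: "0 < c"
  shows "({0<..}, hyperbola_arc_rev c) \<in> regular_arcs hyperbola_plus"
proof (rule regular_arcsI[where D = "\<lambda>t. (- (c / t\<^sup>2), 1 / c)"])
  show "inj_on (hyperbola_arc_rev c) {0<..}"
    using c by (auto simp: inj_on_def hyperbola_arc_rev_def)
  show "(hyperbola_arc_rev c has_vector_derivative (- (c / t\<^sup>2), 1 / c)) (at t)" if "t \<in> {0<..}" for t
    unfolding hyperbola_arc_rev_def
  proof (rule has_vector_derivative_Pair)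
    show "((\<lambda>t. c / t) has_vector_derivative - (c / t\<^sup>2)) (at t)"
      using that by (auto intro!: derivative_eq_intros simp flip: has_real_derivative_iff_has_vector_derivative
          simp: power2_eq_square)
    show "((\<lambda>t. t / c) has_vector_derivative 1 / c) (at t)"
      using c by (auto intro!: derivative_eq_intros simp flip: has_real_derivative_iff_has_vector_derivative)
  qed
qed (use c in \<open>auto intro!: hyperbola_arc_in continuous_intros simp: is_interval_def zero_prod_def\<close>)

text \<open>\<open>N\<close> minus its image under inversion, carried over to the hyperbola.\<close>

definition hyperbola_measure :: "real \<Rightarrow> real measure \<Rightarrow> (real \<times> real) set \<Rightarrow> complex" where
  "hyperbola_measure c N = (\<lambda>A. complex_of_real (measure (distr N borel (hyperbola_arc c)) A
     - measure (distr N borel (hyperbola_arc_rev c)) A))"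

locale unit_interval_measure = finite_measure N for N :: "real measure" +
  assumes sets_N [measurable_cong]: "sets N = sets borel"
    and null_outside: "emeasure N (- {0<..<1}) = 0"
begin

lemma space_N [simp]: "space N = UNIV"
  using sets_eq_imp_space_eq[OF sets_N] by simp

lemma emeasure_0_outside:
  assumes "A \<inter> {0<..<1} = {}"
  shows "emeasure N A = 0"
proof -
  have "emeasure N A \<le> emeasure N (- {0<..<1})"
    using assms sets_N by (intro emeasure_mono) auto
  then show ?thesis using null_outside by simp
qed

lemma emeasure_hyperbola_arc:
  assumes "A \<in> sets borel"
  shows "emeasure (distr N borel (hyperbola_arc c)) A = emeasure N (hyperbola_arc c -` A)"
    and "emeasure (distr N borel (hyperbola_arc_rev c)) A = emeasure N (hyperbola_arc_rev c -` A)"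
  using assms by (auto simp: emeasure_distr)

text \<open>A strip left of the line x1 = c meets only the first arc, so it recovers the values of
  \<open>N\<close> on intervals.\<close>

lemma hyperbola_measure_strip:
  assumes c: "0 < c" and ab: "0 \<le> a" "b \<le> 1"
  shows "hyperbola_measure c N {y. c * a < fst y \<and> fst y < c * b} = measure N {a<..<b}"
proof -
  let ?A = "{y. c * a < fst y \<and> fst y < c * b} :: (real \<times> real) set"
  have A: "?A \<in> sets borel"
    by (intro borel_open open_Collect_conj open_Collect_less continuous_intros)
  have "hyperbola_arc c -` ?A = {a<..<b}" using c by (auto simp: hyperbola_arc_def)
  moreover have "hyperbola_arc_rev c -` ?A \<inter> {0<..<1} = {}"
  proof -
    have False if "0 < t" "t < 1" "c / t < c * b" for t
    proof -
      have "c * b \<le> c * 1" using c ab by (intro mult_left_mono) auto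
      also have "c * 1 < c / t" using that c by (simp add: field_simps)
      finally show False using that by simp
    qed
    then show ?thesis by (auto simp: hyperbola_arc_rev_def)
  qed
  ultimately show ?thesis
    using emeasure_hyperbola_arc[OF A, of c] emeasure_0_outside
    by (simp add: hyperbola_measure_def measure_def)
qed

text \<open>The line x1 = c separates the two image measures, so they are the Jordan decomposition
  and can be integrated separately.\<close>

lemma fourier_transform_hyperbola_measure:
  assumes c: "0 < c"
  shows "fourier_transform (hyperbola_measure c N) x
    = (\<integral>t. exp (\<i> * complex_of_real (pi * (fst x * (c * t) + snd x * (1 / (c * t))))) \<partial>N)
      - (\<integral>t. exp (\<i> * complex_of_real (pi * (fst x * (c / t) + snd x * (t / c)))) \<partial>N)"
proof -
  let ?S = "{y. fst y < c} :: (real \<times> real) set"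
  have "open ?S" by (intro open_Collect_less continuous_intros)
  then have S: "?S \<in> sets borel" "- ?S \<in> sets borel" by auto
  have "emeasure (distr N borel (hyperbola_arc c)) (- ?S) = 0"
    unfolding emeasure_hyperbola_arc[OF S(2)] using c
    by (intro emeasure_0_outside) (auto simp: hyperbola_arc_def)
  moreover have "emeasure (distr N borel (hyperbola_arc_rev c)) ?S = 0"
    unfolding emeasure_hyperbola_arc[OF S(1)] using c
    by (intro emeasure_0_outside) (auto simp: hyperbola_arc_rev_def field_simps)
  moreover define e where "e y = exp (\<i> * complex_of_real (pi * (fst x * fst y + snd x * snd y)))" for y :: "real \<times> real"
  moreover have [measurable]: "e \<in> borel_measurable borel"
    unfolding e_def by (intro borel_measurable_continuous_onI continuous_intros)
  ultimately have "fourier_transform (hyperbola_measure c N) x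
      = integral\<^sup>L (distr N borel (hyperbola_arc c)) e - integral\<^sup>L (distr N borel (hyperbola_arc_rev c)) e"
    unfolding fourier_transform_def hyperbola_measure_def e_def[symmetric] using S
    by (intro complex_measure_integral_diff_singular[where S = ?S]) (auto intro!: finite_measure_distr)
  also have "\<dots> = (\<integral>t. e (hyperbola_arc c t) \<partial>N) - (\<integral>t. e (hyperbola_arc_rev c t) \<partial>N)"
    by (simp add: integral_distr)
  finally show ?thesis by (simp add: e_def hyperbola_arc_def hyperbola_arc_rev_def)
qed

text \<open>An arc-length null set has Lebesgue null preimages under both regular arcs, hence
  \<open>N\<close>-null ones.\<close>

lemma hyperbola_measure_in_AC:
  assumes c: "0 < c" and ac: "absolutely_continuous lborel N"
    and \<Lambda>: "\<And>x. x \<in> \<Lambda> \<Longrightarrow> fourier_transform (hyperbola_measure c N) x = 0"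
  shows "hyperbola_measure c N \<in> AC hyperbola_plus \<Lambda>"
proof -
  have null: "measure (distr N borel (hyperbola_arc c)) A = 0 \<and> measure (distr N borel (hyperbola_arc_rev c)) A = 0"
    if "A \<in> sets borel" "emeasure N (hyperbola_arc c -` A) = 0" "emeasure N (hyperbola_arc_rev c -` A) = 0" for A
    using that emeasure_hyperbola_arc[OF that(1), of c] by (simp add: measure_def)
  have "complex_borel_measure (hyperbola_measure c N)"
    unfolding hyperbola_measure_def
    by (rule complex_borel_measure_diff) (auto intro!: finite_measure_distr)
  moreover have "hyperbola_measure c N A = 0" if "A \<in> sets borel" "A \<inter> hyperbola_plus = {}" for A
  proof -
    have "hyperbola_arc c -` A \<inter> {0<..<1} = {}" "hyperbola_arc_rev c -` A \<inter> {0<..<1} = {}"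
      using that(2) hyperbola_arc_in[OF c] by (blast dest: greaterThanLessThan_iff[THEN iffD1])+
    then show ?thesis using null[OF that(1)] emeasure_0_outside by (simp add: hyperbola_measure_def)
  qed
  moreover have "hyperbola_measure c N A = 0" if A: "A \<in> null_sets (arc_length hyperbola_plus)" for A
  proof -
    have N0: "emeasure N (\<gamma> -` A) = 0"
      if arc: "({0<..}, \<gamma>) \<in> regular_arcs hyperbola_plus" and [measurable]: "\<gamma> \<in> borel_measurable borel" for \<gamma>
    proof -
      have [measurable]: "A \<in> sets borel" by (rule AE_notin_null_set_arc_length[OF that A])
      have "AE t in lborel. t \<notin> \<gamma> -` A \<inter> {0<..}"
        using AE_notin_null_set_arc_length(2)[OF that A] by eventually_elim auto
      moreover have pre: "\<gamma> -` A \<in> sets borel"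
        using measurable_sets[of \<gamma> borel borel A] by simp
      ultimately have "\<gamma> -` A \<inter> {0<..} \<in> null_sets lborel"
        by (subst (asm) AE_iff_null_sets[symmetric]) auto
      then have "emeasure N (\<gamma> -` A \<inter> {0<..}) = 0"
        using ac by (auto simp: absolutely_continuous_def)
      moreover have "emeasure N (\<gamma> -` A - {0<..}) = 0" by (rule emeasure_0_outside) auto
      moreover have "emeasure N (\<gamma> -` A) \<le> emeasure N (\<gamma> -` A \<inter> {0<..}) + emeasure N (\<gamma> -` A - {0<..})"
        using pre by (intro order_trans[OF _ emeasure_subadditive] emeasure_mono) (auto simp: sets_N)
      ultimately show ?thesis by simp
    qed
    have "A \<in> sets borel"
      by (rule AE_notin_null_set_arc_length[OF hyperbola_arc_regular[OF c] _ A]) simp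
    then show ?thesis
      using null N0[OF hyperbola_arc_regular[OF c]] N0[OF hyperbola_arc_rev_regular[OF c]]
      by (simp add: hyperbola_measure_def)
  qed
  ultimately show ?thesis using \<Lambda> by (auto simp: AC_def)
qed

end

text \<open>Evaluation at \<open>A k\<close> kills every later function but not \<open>f k\<close>,
  so \<open>f k\<close> is outside the span of the later ones. Prepending one function at a time
  gives independent families of any size.\<close>

lemma infinite_dimensional_triangular:
  fixes f :: "nat \<Rightarrow> 'a \<Rightarrow> complex"
  assumes V: "\<And>n. f n \<in> V" and A: "\<And>n. f n (A n) \<noteq> 0" and tri: "\<And>m n. n < m \<Longrightarrow> f m (A n) = 0"
  shows "infinite_dimensional V"
  unfolding infinite_dimensional_def
proof
  assume "\<exists>B. finite B \<and> V \<subseteq> complex_fun.span B"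
  then obtain B where B: "finite B" "V \<subseteq> complex_fun.span B" by blast
  have notin: "f k \<notin> complex_fun.span (f ` {Suc k..<l})" for k l
  proof
    have "complex_fun.subspace {g :: 'a \<Rightarrow> complex. g (A k) = 0}"
      by (rule complex_fun.subspaceI) auto
    moreover have "f ` {Suc k..<l} \<subseteq> {g. g (A k) = 0}" using tri by auto
    ultimately have "complex_fun.span (f ` {Suc k..<l}) \<subseteq> {g. g (A k) = 0}"
      by (intro complex_fun.span_minimal)
    moreover assume "f k \<in> complex_fun.span (f ` {Suc k..<l})"
    ultimately show False using A by blast
  qed
  have ind: "\<not> complex_fun.dependent (f ` {k..<k + n})" for k n
  proof (induction n arbitrary: k)
    case 0
    then show ?case by (simp add: complex_fun.independent_empty)
  next
    case (Suc n)
    have "{k..<k + Suc n} = insert k {Suc k..<Suc k + n}" by auto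
    then show ?case using complex_fun.independent_insertI[OF notin Suc.IH[of "Suc k"]] by simp
  qed
  have "inj f"
  proof (rule linorder_injI)
    show "f m \<noteq> f n" if "m < n" for m n using A[of m] tri[OF that] by metis
  qed
  have "card (f ` {0..<0 + Suc (card B)}) \<le> card B"
    using complex_fun.independent_span_bound[OF B(1) ind] B(2) V by (meson image_subsetI subset_iff)
  then show False by (simp add: card_image[OF inj_on_subset[OF \<open>inj f\<close> subset_UNIV]])
qed

subsection \<open>The space of annihilating measures\<close>

text \<open>Collects what remains of the dynamics for the main proof: images under t and 1/t that
  agree modulo \<open>p\<close>, and a support ending exactly at p + r.\<close>

lemma (in trapezoid) balanced_measure_exists:
  "\<exists>N. unit_interval_measure N \<and> absolutely_continuous lborel N
     \<and> (\<forall>e :: real \<Rightarrow> complex. e \<in> borel_measurable borel \<longrightarrow> (\<forall>t (k::int). e (t + of_int k * p) = e t)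
          \<longrightarrow> integral\<^sup>L N e = (\<integral>t. e (1/t) \<partial>N))
     \<and> (\<forall>a b. 0 < a \<longrightarrow> a < b \<longrightarrow> b \<le> p + r \<longrightarrow> measure N {a<..<b} \<noteq> 0)
     \<and> (\<forall>a b. p + r \<le> a \<longrightarrow> measure N {a<..<b} = 0)"
proof -
  obtain H M where M: "0 \<le> M" and g: "good M H" and inv: "\<And>t. t \<in> {0..p} \<Longrightarrow> transfer H t = H t"
    using invariant_density_exists by blast
  have [measurable]: "H \<in> borel_measurable borel" using g by (simp add: good_def)
  define N where "N = density lborel (\<lambda>t. ennreal (density_on H t))"
  have sN: "sets N = sets borel" by (simp add: N_def)
  have null: "emeasure N A = 0" if "A \<in> sets borel" "\<And>t. t \<in> A \<Longrightarrow> density_on H t = 0" for A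
  proof -
    have "emeasure N A = (\<integral>\<^sup>+t. ennreal (density_on H t) * indicator A t \<partial>lborel)"
      unfolding N_def using that by (intro emeasure_density) auto
    also have "\<dots> = (\<integral>\<^sup>+(t::real). 0 \<partial>lborel)"
      by (intro nn_integral_cong) (use that in \<open>auto simp: indicator_def\<close>)
    finally show ?thesis by simp
  qed
  have "unit_interval_measure N"
  proof (intro unit_interval_measure.intro unit_interval_measure_axioms.intro finite_measureI)
    show "emeasure N (space N) \<noteq> \<infinity>"
      using emeasure_density_UNIV[OF g M] by (simp add: N_def)
    show "emeasure N (- {0<..<1}) = 0"
      by (rule null) (auto simp: density_on_def)
  qed (rule sN)
  moreover from this interpret N: unit_interval_measure N .
  have "absolutely_continuous lborel N"
    unfolding N_def by (rule absolutely_continuousI_density) measurable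
  moreover have "measure N {a<..<b} \<noteq> 0" if "0 < a" "a < b" "b \<le> p + r" for a b
    using emeasure_density_interval_pos[OF g M inv that] N.emeasure_eq_measure by (simp add: N_def)
  moreover have "measure N {a<..<b} = 0" if "p + r \<le> a" for a b
    using null[of "{a<..<b}"] that by (simp add: measure_def density_on_def chi_eq_0)
  ultimately show ?thesis
    using integral_density_inverse[OF g M inv] unfolding N_def by blast
qed

theorem theorem1p2:
  fixes \<alpha> \<beta> :: real
  assumes "\<alpha> > 0" and "\<beta> > 0" and "\<alpha> * \<beta> > 4"
  shows "infinite_dimensional (AC hyperbola_plus (lattice_cross \<alpha> \<beta>))"
proof -
  \<comment> \<open>The largest integer below \<alpha>\<beta>/4, so that 4q < \<alpha>\<beta> \<le>
    4(q + 1) \<le> 8q.\<close>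
  define q :: int where "q = \<lceil>\<alpha> * \<beta> / 4\<rceil> - 1"
  have q: "1 \<le> q" "of_int q < \<alpha> * \<beta> / 4" "\<alpha> * \<beta> / 4 \<le> of_int q + 1"
    using assms(3) by (auto simp: q_def) linarith+
  define a where "a = \<alpha> / of_int q"
  have \<alpha>: "\<alpha> = of_int q * a" using q by (simp add: a_def)
  have a: "0 < a" using assms q by (simp add: a_def)
  have "1 \<le> real_of_int q" using q by simp
  then have "real_of_int q * 4 < real_of_int q * (a * \<beta>)" "real_of_int q * (a * \<beta>) \<le> real_of_int q * 8"
    using q(2,3) unfolding \<alpha> mult.assoc by linarith+
  then have ab: "4 < a * \<beta>" "a * \<beta> \<le> 8"
    using q by (auto simp: mult_less_cancel_left mult_le_cancel_left)
  \<comment> \<open>The scaling \<open>c\<close> is chosen so that a c = \<beta>/c = s. Both axes of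
    the cross then give the frequencies s k, whose characters have the period p = 2/s.\<close>
  define s where "s = sqrt (a * \<beta>)"
  define p where "p = 2 / s"
  define c where "c = sqrt (\<beta> / a)"
  have s: "2 < s" "s * s = a * \<beta>"
    using ab real_less_rsqrt[of 2 "a * \<beta>"] by (auto simp: s_def)
  have p: "0 < p" "p < 1" "1/2 \<le> p * p"
    using s ab by (auto simp: p_def field_simps)
  have c: "0 < c" using a assms by (simp add: c_def)
  have "c\<^sup>2 = \<beta> / a" using a assms by (simp add: c_def)
  then have "(a * c)\<^sup>2 = s\<^sup>2" "(\<beta> / c)\<^sup>2 = s\<^sup>2"
    using a assms s(2) by (auto simp: power_mult_distrib power_divide power2_eq_square[of a]
        power2_eq_square[of \<beta>] power2_eq_square[of s])
  then have ac: "a * c = s" "\<beta> / c = s"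
    using a c assms s by (auto simp: power2_eq_iff_nonneg)
  define r where "r n = (1 - p) / real (Suc n)" for n
  have r: "0 < r n" "r n \<le> 1 - p" for n
    using p by (auto simp: r_def divide_le_eq mult_le_cancel_left1)
  have r_less: "r m < r n" if "n < m" for m n
    unfolding r_def using that p by (intro divide_strict_left_mono) auto
  have "trapezoid p (r n)" for n
    by unfold_locales (use p r in auto)
  then have "\<forall>n. \<exists>N. unit_interval_measure N \<and> absolutely_continuous lborel N
     \<and> (\<forall>e :: real \<Rightarrow> complex. e \<in> borel_measurable borel \<longrightarrow> (\<forall>t (k::int). e (t + of_int k * p) = e t)
          \<longrightarrow> integral\<^sup>L N e = (\<integral>t. e (1/t) \<partial>N))
     \<and> (\<forall>a b. 0 < a \<longrightarrow> a < b \<longrightarrow> b \<le> p + r n \<longrightarrow> measure N {a<..<b} \<noteq> 0)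
     \<and> (\<forall>a b. p + r n \<le> a \<longrightarrow> measure N {a<..<b} = 0)"
    using trapezoid.balanced_measure_exists by blast
  then obtain N where N: "\<And>n. unit_interval_measure (N n)" "\<And>n. absolutely_continuous lborel (N n)"
    and bal: "\<And>n (e :: real \<Rightarrow> complex). e \<in> borel_measurable borel \<Longrightarrow> (\<And>t (k::int). e (t + of_int k * p) = e t)
          \<Longrightarrow> integral\<^sup>L (N n) e = (\<integral>t. e (1/t) \<partial>(N n))"
    and pos: "\<And>n a b. 0 < a \<Longrightarrow> a < b \<Longrightarrow> b \<le> p + r n \<Longrightarrow> measure (N n) {a<..<b} \<noteq> 0"
    and zero: "\<And>n a b. p + r n \<le> a \<Longrightarrow> measure (N n) {a<..<b} = 0"
    by metis
  \<comment> \<open>The characters have period \<open>p\<close> because s p = 2, so the balance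
    property applies.\<close>
  have character: "(\<integral>t. exp (\<i> * complex_of_real (pi * (s * of_int k * t))) \<partial>N n)
      = (\<integral>t. exp (\<i> * complex_of_real (pi * (s * of_int k * (1/t)))) \<partial>N n)" for n and k :: int
  proof (rule bal)
    show "(\<lambda>t. exp (\<i> * complex_of_real (pi * (s * of_int k * t)))) \<in> borel_measurable borel"
      by (intro borel_measurable_continuous_onI continuous_intros)
    fix t and l :: int
    have "s * p = 2" using s by (simp add: p_def)
    then have "pi * (s * of_int k * (t + of_int l * p)) = pi * (s * of_int k * t) + 2 * of_int (k * l) * pi"
      by (simp add: algebra_simps)
    moreover have "exp (\<i> * complex_of_real (2 * of_int (k * l) * pi)) = 1"
      using exp_integer_2pi[of "of_int (k * l)"] by (simp add: mult_ac)
    ultimately show "exp (\<i> * complex_of_real (pi * (s * of_int k * (t + of_int l * p))))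
        = exp (\<i> * complex_of_real (pi * (s * of_int k * t)))"
      by (simp only: of_real_add distrib_left exp_add mult_1_right)
  qed
  show ?thesis
  \<comment> \<open>The strip over (p + r (n+1), p + r n) is charged by the measure with index
    \<open>n\<close>, while for m > n the support ends at p + r m \<le> p + r (n+1).\<close>
  proof (rule infinite_dimensional_triangular[where f = "\<lambda>n. hyperbola_measure c (N n)"
        and A = "\<lambda>n. {y. c * (p + r (Suc n)) < fst y \<and> fst y < c * (p + r n)}"])
    fix n
    interpret unit_interval_measure "N n" by (rule N)
    show "hyperbola_measure c (N n) \<in> AC hyperbola_plus (lattice_cross \<alpha> \<beta>)"
    proof (rule hyperbola_measure_in_AC[OF c N(2)])
      fix x assume "x \<in> lattice_cross \<alpha> \<beta>"
      then consider k :: int where "x = (\<alpha> * of_int k, 0)" | k :: int where "x = (0, \<beta> * of_int k)"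
        by (auto simp: lattice_cross_def)
      then show "fourier_transform (hyperbola_measure c (N n)) x = 0"
      proof cases
        case 1
        \<comment> \<open>Since \<alpha> = q a, only the multiples of \<open>q\<close> occur as
          frequency indices.\<close>
        have *: "\<alpha> * of_int k * (c * t) = s * of_int (q * k) * t" "\<alpha> * of_int k * (c / t) = s * of_int (q * k) * (1/t)" for t
          by (auto simp: \<alpha> ac(1)[symmetric])
        show ?thesis
          unfolding fourier_transform_hyperbola_measure[OF c] 1
          by (simp only: fst_conv snd_conv mult_zero_left add_0_right * character diff_self)
      next
        case 2
        have *: "\<beta> * of_int k * (1 / (c * t)) = s * of_int k * (1/t)" "\<beta> * of_int k * (t / c) = s * of_int k * t" for t
          by (auto simp: ac(2)[symmetric])
        show ?thesis
          unfolding fourier_transform_hyperbola_measure[OF c] 2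
          by (simp only: fst_conv snd_conv mult_zero_left add_0_left * character diff_self)
      qed
    qed
    show "hyperbola_measure c (N n) {y. c * (p + r (Suc n)) < fst y \<and> fst y < c * (p + r n)} \<noteq> 0"
      using p r[of "Suc n"] r[of n] r_less[of n "Suc n"] pos[of "p + r (Suc n)" "p + r n" n]
      by (subst hyperbola_measure_strip[OF c]) auto
  next
    fix m n :: nat assume "n < m"
    interpret unit_interval_measure "N m" by (rule N)
    have "r m \<le> r (Suc n)" using r_less[of "Suc n" m] \<open>n < m\<close> by (cases "m = Suc n") auto
    then show "hyperbola_measure c (N m) {y. c * (p + r (Suc n)) < fst y \<and> fst y < c * (p + r n)} = 0"
      using p r[of "Suc n"] r[of n] zero[of m "p + r (Suc n)" "p + r n"]
      by (subst hyperbola_measure_strip[OF c]) auto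
  qed
qed

end
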